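(* Let $d\ge1$ and let $\mathscr B$ be the stratifying set for the natural action of $\mathrm{GL}_3(\mathbb R)$ on $V=\mathbb R[x,y,z]_d$. Then $$\mathscr B=\{\beta=\operatorname{mcc}(\{\alpha_i,\alpha_j\}) : \alpha_i,\alpha_j\in\Delta(V)\text{ with }\alpha_j-\alpha_i\notin\Delta(\mathfrak g)\}\cap\overline{\mathfrak a^+}.$$
   Context: $V=\mathbb R[x,y,z]_d$ is the space of real ternary forms of degree $d$; $G=\mathrm{GL}_3(\mathbb R)$ acts by $(g\cdot p)(u)=p(g^{-1}u)$, $u\in\mathbb R^3$, with differential $\pi:\mathfrak{gl}_3(\mathbb R)\to\mathfrak{gl}(V)$. $\mathfrak g=\mathfrak{gl}_3(\mathbb R)$ has inner product $\langle\!\langle X,Y\rangle\!\rangle=\operatorname{tr}(XY^{T})$; $K=\mathrm O(3)$, $\mathfrak p=\operatorname{sym}(3)$ (symmetric matrices). $\mathfrak a$ is the space of diagonal matrices, written as triples $(a_1,a_2,a_3)$, and $\mathfrak a^+=\{(a_1,a_2,a_3):a_1<a_2<a_3\}$. The inner product $\langle\cdot,\cdot\rangle$ on $V$ makes monomials orthogonal with $\|x^{d_1}y^{d_2}z^{d_3}\|^2=d_1!\,d_2!\,d_3!$. The root set is $\Delta(\mathfrak g)=\{E_{ii}-E_{jj}:i\ne j\}$ and the weight set is $\Delta(V)=\{-(d_1,d_2,d_3): d_i\in\mathbb Z_{\ge0},\ d_1+d_2+d_3=d\}\subset\mathfrak a$. For a finite set $\Phi\subset\mathfrak a$, $\operatorname{mcc}(\Phi)$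 is the unique vector of minimal norm in the convex hull of $\Phi$. Moment map: $m_{\mathfrak g}:V\smallsetminus\{0\}\to\mathfrak p$, $\langle\!\langle m_{\mathfrak g}(p),X\rangle\!\rangle=\frac1{\|p\|^2}\langle\pi(X)p,p\rangle$ for all $X\in\mathfrak p$; $F_{\mathfrak g}=\|m_{\mathfrak g}\|^2$. For $\beta\in\mathfrak a$, $\mathscr C(\beta)=\{p\in V\smallsetminus\{0\}: p\text{ is a critical point of }F_{\mathfrak g}\text{ and }m_{\mathfrak g}(p)\in\operatorname{Ad}(K)\beta\}$, and the stratifying set is $\mathscr B=\{\beta\in\overline{\mathfrak a^+}:\mathscr C(\beta)\neq\emptyset\}$ (equivalently, those $\beta\in\overline{\mathfrak a^+}$ for which the stratum $\mathscr S_\beta$, consisting of the $v$ whose integral curve $s_v(t)$ of $\operatorname{grad}F_{\mathfrak g}$ through $v$ satisfies $\lim_{t\to-\infty}s_v(t)\in\mathscr C(\beta)$, is nonempty). *)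

theory Defs
  imports "HOL-Analysis.Analysis"
begin

section \<open>Real ternary polynomials\<close>

text \<open>
  A polynomial in three real variables is identified with the function on \<open>\<real>\<^sup>3\<close> that it induces
  (injective, since the field is infinite). Exponents are elements of \<open>nat^3\<close>.
\<close>

definition mono_fun :: "nat^3 \<Rightarrow> real^3 \<Rightarrow> real"
  where "mono_fun e u = (\<Prod>i\<in>UNIV. (u $ i) ^ (e $ i))"

lemma mono_fun_3: "mono_fun e u = (u$1)^(e$1) * (u$2)^(e$2) * (u$3)^(e$3)"
  unfolding mono_fun_def UNIV_3 by (simp add: ac_simps)

lemma mono_fun_plus: "mono_fun (e + f) u = mono_fun e u * mono_fun f u"
  by (simp add: mono_fun_3 power_add algebra_simps)

lemma real_polynomial_function_nth: "real_polynomial_function (\<lambda>u::real^3. u $ i)"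
  by (intro real_polynomial_function.intros(1) bounded_linear_vec_nth)

lemma real_polynomial_function_mono_fun: "real_polynomial_function (mono_fun e)"
  unfolding mono_fun_def [abs_def]
  by (intro real_polynomial_function_prod real_polynomial_function_power
      real_polynomial_function_nth) auto

typedef tpoly = "{p :: real^3 \<Rightarrow> real. real_polynomial_function p}"
  morphisms poly_fun Abs_tpoly
  by (rule exI [of _ "\<lambda>_. 0"]) auto

lemma real_polynomial_poly_fun: "real_polynomial_function (poly_fun p)"
  using poly_fun by blast

lemma poly_fun_Abs: "real_polynomial_function p \<Longrightarrow> poly_fun (Abs_tpoly p) = p"
  by (simp add: Abs_tpoly_inverse)

lemma tpoly_eqI: "(\<And>u. poly_fun p u = poly_fun q u) \<Longrightarrow> p = q"
  by (metis poly_fun_inject ext)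

lemma tpoly_eq_iff: "p = q \<longleftrightarrow> (\<forall>u. poly_fun p u = poly_fun q u)"
  using tpoly_eqI by blast

instantiation tpoly :: real_vector
begin

definition "0 = Abs_tpoly (\<lambda>_. 0)"
definition "p + q = Abs_tpoly (\<lambda>u. poly_fun p u + poly_fun q u)"
definition "- p = Abs_tpoly (\<lambda>u. - poly_fun p u)"
definition "p - q = Abs_tpoly (\<lambda>u. poly_fun p u - poly_fun q u)"
definition "scaleR r p = Abs_tpoly (\<lambda>u. r * poly_fun p u)"

lemma poly_fun_0 [simp]: "poly_fun 0 u = 0"
  unfolding zero_tpoly_def by (subst poly_fun_Abs) auto

lemma poly_fun_add [simp]: "poly_fun (p + q) u = poly_fun p u + poly_fun q u"
  unfolding plus_tpoly_def
  by (subst poly_fun_Abs) (auto intro: real_polynomial_poly_fun)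

lemma poly_fun_uminus [simp]: "poly_fun (- p) u = - poly_fun p u"
  unfolding uminus_tpoly_def
  by (subst poly_fun_Abs) (auto intro: real_polynomial_poly_fun)

lemma poly_fun_minus [simp]: "poly_fun (p - q) u = poly_fun p u - poly_fun q u"
  unfolding minus_tpoly_def
  by (subst poly_fun_Abs) (auto intro: real_polynomial_poly_fun)

lemma poly_fun_scaleR [simp]: "poly_fun (r *\<^sub>R p) u = r * poly_fun p u"
  unfolding scaleR_tpoly_def
  by (subst poly_fun_Abs)
    (auto intro: real_polynomial_poly_fun real_polynomial_function.intros)

instance
  by standard (auto simp: tpoly_eq_iff algebra_simps)

end

subsection \<open>Coefficients\<close>

definition is_coeffs :: "(nat^3 \<Rightarrow> real) \<Rightarrow> (real^3 \<Rightarrow> real) \<Rightarrow> bool"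
  where "is_coeffs c f \<longleftrightarrow>
    finite {e. c e \<noteq> 0} \<and> (\<forall>u. f u = (\<Sum>e | c e \<noteq> 0. c e * mono_fun e u))"

definition coeff3 :: "tpoly \<Rightarrow> nat^3 \<Rightarrow> real"
  where "coeff3 p = (THE c. is_coeffs c (poly_fun p))"

lemma sum_support_superset:
  fixes c :: "nat^3 \<Rightarrow> real"
  assumes "finite S" "{e. c e \<noteq> 0} \<subseteq> S"
  shows "(\<Sum>e | c e \<noteq> 0. c e * g e) = (\<Sum>e\<in>S. c e * (g e :: real))"
  by (rule sum.mono_neutral_left) (use assms in auto)

lemma vec3_eq_iff: "x = y \<longleftrightarrow> x$1 = y$1 \<and> x$2 = y$2 \<and> x$3 = (y$3)" for x y :: "'a^3"
  by (simp add: vec_eq_iff forall_3)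

lemma mono_fun_independent:
  assumes fin: "finite {e. c e \<noteq> (0::real)}"
    and zero: "\<And>u. (\<Sum>e | c e \<noteq> 0. c e * mono_fun e u) = 0"
  shows "c e = 0"
proof -
  define N where "N = Max (insert 0 ((\<lambda>(e, i). e $ i) ` ({e. c e \<noteq> 0} \<times> UNIV)))"
  define v :: "nat \<Rightarrow> nat \<Rightarrow> nat \<Rightarrow> nat^3" where "v i j k = vector [i, j, k]" for i j k
  have v [simp]: "v i j k $ 1 = i" "v i j k $ 2 = j" "v i j k $ 3 = k" for i j k
    by (simp_all add: v_def)
  define S :: "(nat^3) set" where "S = (\<lambda>(i, j, k). v i j k) ` ({..N} \<times> {..N} \<times> {..N})"
  have finS: "finite S"
    by (simp add: S_def)
  have le: "f $ i \<le> N" if "c f \<noteq> 0" for f i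
    unfolding N_def using fin that by (intro Max_ge) (auto intro!: image_eqI [of _ _ "(f, i)"])
  have sub: "{e. c e \<noteq> 0} \<subseteq> S"
  proof
    fix f assume "f \<in> {e. c e \<noteq> 0}"
    then have "f = v (f$1) (f$2) (f$3)" "f$1 \<le> N" "f$2 \<le> N" "f$3 \<le> N"
      using le by (auto simp: vec3_eq_iff)
    then show "f \<in> S"
      unfolding S_def by (intro image_eqI [of _ _ "(f$1, f$2, f$3)"]) auto
  qed
  have inj: "inj_on (\<lambda>(i, j, k). v i j k) ({..N} \<times> {..N} \<times> {..N})"
    by (auto simp: inj_on_def vec3_eq_iff)
  have eq: "(\<Sum>i\<le>N. (\<Sum>j\<le>N. (\<Sum>k\<le>N. c (v i j k) * z^k) * y^j) * x^i) = 0" for x y z :: real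
  proof -
    have "0 = (\<Sum>e\<in>S. c e * mono_fun e (vector [x, y, z]))"
      using zero [of "vector [x, y, z]"] sum_support_superset [OF finS sub] by metis
    also have "\<dots> = (\<Sum>(i, j, k)\<in>{..N} \<times> {..N} \<times> {..N}. c (v i j k) * (x^i * y^j * z^k))"
      unfolding S_def by (subst sum.reindex [OF inj]) (auto simp: mono_fun_3 intro!: sum.cong)
    also have "\<dots> = (\<Sum>i\<le>N. \<Sum>j\<le>N. \<Sum>k\<le>N. c (v i j k) * (x^i * y^j * z^k))"
      by (simp add: sum.cartesian_product)
    also have "\<dots> = (\<Sum>i\<le>N. (\<Sum>j\<le>N. (\<Sum>k\<le>N. c (v i j k) * z^k) * y^j) * x^i)"
      by (simp add: sum_distrib_left sum_distrib_right algebra_simps)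
    finally show ?thesis by simp
  qed
  have "c (v i j k) = 0" if "i \<le> N" "j \<le> N" "k \<le> N" for i j k
  proof -
    have "(\<Sum>j\<le>N. (\<Sum>k\<le>N. c (v i j k) * z^k) * y^j) = 0" for y z
      using eq [where y = y and z = z] that polyfun_eq_0 [of "\<lambda>i. \<Sum>j\<le>N. (\<Sum>k\<le>N. c (v i j k) * z^k) * y^j" N]
      by blast
    then have "(\<Sum>k\<le>N. c (v i j k) * z^k) = 0" for z
      using that polyfun_eq_0 [of "\<lambda>j. \<Sum>k\<le>N. c (v i j k) * z^k" N] by blast
    then show ?thesis
      using that polyfun_eq_0 [of "\<lambda>k. c (v i j k)" N] by blast
  qed
  then have "c e = 0" if "e \<in> S"
    using that by (auto simp: S_def)
  then show ?thesis
    using sub by blast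
qed

lemma is_coeffs_superset:
  assumes "finite S" "\<And>e. e \<notin> S \<Longrightarrow> c e = 0" "\<And>u. f u = (\<Sum>e\<in>S. c e * mono_fun e u)"
  shows "is_coeffs c f"
proof -
  have "{e. c e \<noteq> 0} \<subseteq> S" using assms(2) by blast
  then show ?thesis
    using assms sum_support_superset [OF assms(1)] finite_subset
    by (simp add: is_coeffs_def)
qed

lemma is_coeffsD:
  assumes "is_coeffs c f" "finite S" "{e. c e \<noteq> 0} \<subseteq> S"
  shows "f u = (\<Sum>e\<in>S. c e * mono_fun e u)"
  using assms sum_support_superset [OF assms(2,3)] by (simp add: is_coeffs_def)

lemma is_coeffs_scale: "is_coeffs c f \<Longrightarrow> is_coeffs (\<lambda>e. r * c e) (\<lambda>u. r * f u)"
  by (rule is_coeffs_superset [of "{e. c e \<noteq> 0}"])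
    (auto simp: is_coeffs_def sum_distrib_left mult.assoc)

lemma is_coeffs_add:
  assumes "is_coeffs c f" "is_coeffs d g"
  shows "is_coeffs (\<lambda>e. c e + d e) (\<lambda>u. f u + g u)"
proof (rule is_coeffs_superset)
  let ?S = "{e. c e \<noteq> 0} \<union> {e. d e \<noteq> 0}"
  show fin: "finite ?S"
    using assms by (simp add: is_coeffs_def)
  show "f u + g u = (\<Sum>e\<in>?S. (c e + d e) * mono_fun e u)" for u
    using is_coeffsD [OF assms(1) fin] is_coeffsD [OF assms(2) fin]
    by (simp add: sum.distrib distrib_right)
qed auto

lemma is_coeffs_mono: "is_coeffs (\<lambda>f. if f = e then 1 else 0) (mono_fun e)"
  by (rule is_coeffs_superset [of "{e}"]) auto

lemma is_coeffs_sum: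
  assumes "finite I" "\<And>i. i \<in> I \<Longrightarrow> \<exists>c. is_coeffs c (f i)"
  shows "\<exists>c. is_coeffs c (\<lambda>u. \<Sum>i\<in>I. f i u)"
  using assms
proof (induction I rule: finite_induct)
  case empty
  then show ?case
    by (intro exI [of _ "\<lambda>_. 0"]) (simp add: is_coeffs_def)
next
  case (insert i I)
  then obtain c d where "is_coeffs c (f i)" "is_coeffs d (\<lambda>u. \<Sum>i\<in>I. f i u)"
    by blast
  then show ?case
    using is_coeffs_add insert.hyps by fastforce
qed

lemma is_coeffs_exists:
  assumes "real_polynomial_function (f :: real^3 \<Rightarrow> real)"
  shows "\<exists>c. is_coeffs c f"
  using assms
proof (induction f rule: real_polynomial_function.induct)
  case (linear f)
  have "f u = (\<Sum>i\<in>UNIV. f (axis i 1) * mono_fun (axis i 1) u)" for u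
  proof -
    have 1: "mono_fun (axis i 1) u = u $ i" for i
      by (cases i rule: exhaust_3 [THEN disjE])
        (auto simp: mono_fun_def axis_def if_distrib [of "\<lambda>n. _ ^ n"] cong: if_cong)
    have "f u = f (\<Sum>i\<in>UNIV. u $ i *\<^sub>R axis i 1)"
      by (simp add: basis_expansion flip: scalar_mult_eq_scaleR)
    also have "\<dots> = (\<Sum>i\<in>UNIV. u $ i * f (axis i 1))"
      using linear
      by (simp add: bounded_linear.linear linear_sum linear_cmul o_def)
    finally show ?thesis
      by (simp add: 1 [unfolded One_nat_def] mult.commute)
  qed
  then have "f = (\<lambda>u. \<Sum>i\<in>UNIV. f (axis i 1) * mono_fun (axis i 1) u)"
    by (rule ext)
  moreover have "\<exists>c. is_coeffs c (\<lambda>u. \<Sum>i\<in>UNIV. f (axis i 1) * mono_fun (axis i 1) u)"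
    by (rule is_coeffs_sum) (simp, blast intro: is_coeffs_scale [OF is_coeffs_mono])
  ultimately show ?case
    by (rule ssubst [where P = "\<lambda>g. \<exists>c. is_coeffs c g"])
next
  case (const c)
  have "mono_fun 0 u = 1" for u
    by (simp add: mono_fun_def)
  then show ?case
    using is_coeffs_scale [OF is_coeffs_mono, of c 0] by auto
next
  case (add f g)
  then show ?case using is_coeffs_add by blast
next
  case (mult f g)
  then obtain c d where cd: "is_coeffs c f" "is_coeffs d g"
    by blast
  let ?C = "{e. c e \<noteq> 0}" and ?D = "{e. d e \<noteq> 0}"
  have fin: "finite ?C" "finite ?D"
    using cd by (auto simp: is_coeffs_def)
  have "f u * g u = (\<Sum>(a, b)\<in>?C \<times> ?D. (c a * d b) * mono_fun (a + b) u)" for u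
    using is_coeffsD [OF cd(1) fin(1)] is_coeffsD [OF cd(2) fin(2)]
    by (simp add: sum_product sum.cartesian_product mono_fun_plus algebra_simps)
  then have "(\<lambda>u. f u * g u) = (\<lambda>u. \<Sum>x\<in>?C \<times> ?D. (c (fst x) * d (snd x)) * mono_fun (fst x + snd x) u)"
    by (auto simp: case_prod_beta)
  moreover have "\<exists>c'. is_coeffs c' (\<lambda>u. \<Sum>x\<in>?C \<times> ?D. (c (fst x) * d (snd x)) * mono_fun (fst x + snd x) u)"
    by (rule is_coeffs_sum) (simp add: fin, blast intro: is_coeffs_scale [OF is_coeffs_mono])
  ultimately show ?case
    by (rule ssubst [where P = "\<lambda>g. \<exists>c. is_coeffs c g"])
qed

lemma is_coeffs_unique:
  assumes "is_coeffs c f" "is_coeffs d f"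
  shows "c = d"
proof
  fix e
  have *: "is_coeffs (\<lambda>e. c e - d e) (\<lambda>_. 0)"
    using is_coeffs_add [OF assms(1) is_coeffs_scale [OF assms(2), of "-1"]] by simp
  then have "finite {e. c e - d e \<noteq> 0}"
    "(\<Sum>e | c e - d e \<noteq> 0. (c e - d e) * mono_fun e u) = 0" for u
    unfolding is_coeffs_def by (blast, metis)
  then have "c e - d e = 0"
    by (rule mono_fun_independent)
  then show "c e = d e" by simp
qed

lemma is_coeffs_coeff3: "is_coeffs (coeff3 p) (poly_fun p)"
  unfolding coeff3_def
  by (rule theI' [of "\<lambda>c. is_coeffs c (poly_fun p)"])
    (meson is_coeffs_exists is_coeffs_unique real_polynomial_poly_fun)

lemma coeff3_eqI: "is_coeffs c (poly_fun p) \<Longrightarrow> coeff3 p = c"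
  using is_coeffs_coeff3 is_coeffs_unique by blast

lemma finite_coeff3: "finite {e. coeff3 p e \<noteq> 0}"
  using is_coeffs_coeff3 is_coeffs_def by blast

lemma coeff3_add [simp]: "coeff3 (p + q) e = coeff3 p e + coeff3 q e"
proof -
  have "coeff3 (p + q) = (\<lambda>e. coeff3 p e + coeff3 q e)"
    using is_coeffs_add [OF is_coeffs_coeff3 is_coeffs_coeff3, of p q]
    by (intro coeff3_eqI) (simp flip: poly_fun_add)
  then show ?thesis by simp
qed

lemma coeff3_scaleR [simp]: "coeff3 (r *\<^sub>R p) e = r * coeff3 p e"
proof -
  have "coeff3 (r *\<^sub>R p) = (\<lambda>e. r * coeff3 p e)"
    using is_coeffs_scale [OF is_coeffs_coeff3, of r p]
    by (intro coeff3_eqI) (simp flip: poly_fun_scaleR)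
  then show ?thesis by simp
qed

lemma coeff3_eq_0: "coeff3 p = (\<lambda>_. 0) \<Longrightarrow> p = 0"
  using is_coeffs_coeff3 [of p] by (auto simp: is_coeffs_def tpoly_eq_iff)

lemma coeff3_0 [simp]: "coeff3 0 e = 0"
  using coeff3_scaleR [of 0 0 e] by simp

subsection \<open>The inner product\<close>

definition fact_exp :: "nat^3 \<Rightarrow> real"
  where "fact_exp e = (\<Prod>i\<in>UNIV. fact (e $ i))"

lemma fact_exp_pos: "fact_exp e > 0"
  by (auto simp: fact_exp_def intro!: prod_pos)

instantiation tpoly :: real_inner
begin

definition inner_tpoly :: "tpoly \<Rightarrow> tpoly \<Rightarrow> real"
  where "inner_tpoly p q = (\<Sum>e | coeff3 p e \<noteq> 0. fact_exp e * coeff3 p e * coeff3 q e)"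

definition norm_tpoly :: "tpoly \<Rightarrow> real"
  where "norm_tpoly p = sqrt (inner p p)"

definition dist_tpoly :: "tpoly \<Rightarrow> tpoly \<Rightarrow> real"
  where "dist_tpoly p q = norm (p - q)"

definition sgn_tpoly :: "tpoly \<Rightarrow> tpoly"
  where "sgn_tpoly p = p /\<^sub>R norm p"

definition uniformity_tpoly :: "(tpoly \<times> tpoly) filter"
  where "uniformity_tpoly = (INF e\<in>{0<..}. principal {(x, y). dist x y < e})"

definition open_tpoly :: "tpoly set \<Rightarrow> bool"
  where "open_tpoly U = (\<forall>x\<in>U. eventually (\<lambda>(x', y). x' = x \<longrightarrow> y \<in> U) uniformity)"

lemma inner_tpoly_superset:
  assumes "finite S" "\<And>e. e \<notin> S \<Longrightarrow> coeff3 p e = 0 \<or> coeff3 q e = 0"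
  shows "inner p q = (\<Sum>e\<in>S. fact_exp e * coeff3 p e * coeff3 q e)"
proof -
  have "inner p q = (\<Sum>e\<in>S \<union> {e. coeff3 p e \<noteq> 0}. fact_exp e * coeff3 p e * coeff3 q e)"
    unfolding inner_tpoly_def
    by (rule sum.mono_neutral_left) (use assms(1) finite_coeff3 in auto)
  also have "\<dots> = (\<Sum>e\<in>S. fact_exp e * coeff3 p e * coeff3 q e)"
    by (rule sum.mono_neutral_right) (use assms finite_coeff3 in auto)
  finally show ?thesis .
qed

instance
proof
  fix p q r :: tpoly and a :: real
  show "inner p q = inner q p"
    using inner_tpoly_superset [of "{e. coeff3 p e \<noteq> 0}" q p] finite_coeff3
    by (simp add: inner_tpoly_def algebra_simps)
  let ?S = "{e. coeff3 p e \<noteq> 0} \<union> {e. coeff3 q e \<noteq> 0}"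
  have fin: "finite ?S"
    using finite_coeff3 by simp
  have "inner (p + q) r = (\<Sum>e\<in>?S. fact_exp e * coeff3 (p + q) e * coeff3 r e)"
    "inner p r = (\<Sum>e\<in>?S. fact_exp e * coeff3 p e * coeff3 r e)"
    "inner q r = (\<Sum>e\<in>?S. fact_exp e * coeff3 q e * coeff3 r e)"
    by (rule inner_tpoly_superset [OF fin]; auto)+
  then show "inner (p + q) r = inner p r + inner q r"
    by (simp add: sum.distrib algebra_simps)
  show "inner (a *\<^sub>R p) r = a * inner p r"
    using inner_tpoly_superset [of "{e. coeff3 p e \<noteq> 0}" "a *\<^sub>R p" r] finite_coeff3
    by (simp add: inner_tpoly_def sum_distrib_left algebra_simps)
  have nonneg: "fact_exp e * coeff3 p e * coeff3 p e \<ge> 0" for e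
    using fact_exp_pos [of e] by (simp add: mult.assoc)
  then show "0 \<le> inner p p"
    unfolding inner_tpoly_def by (intro sum_nonneg)
  show "inner p p = 0 \<longleftrightarrow> p = 0"
  proof
    assume "inner p p = 0"
    then have "fact_exp e * coeff3 p e * coeff3 p e = 0" if "coeff3 p e \<noteq> 0" for e
      using that nonneg finite_coeff3 unfolding inner_tpoly_def
      by (subst (asm) sum_nonneg_eq_0_iff) auto
    then have "coeff3 p e = 0" for e
      using fact_exp_pos [of e] by fastforce
    then show "p = 0"
      by (intro coeff3_eq_0) auto
  qed (simp add: inner_tpoly_def)
qed (simp_all add: norm_tpoly_def dist_tpoly_def sgn_tpoly_def uniformity_tpoly_def open_tpoly_def)

end

definition monom3 :: "nat^3 \<Rightarrow> tpoly"
  where "monom3 e = Abs_tpoly (mono_fun e)"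

lemma poly_fun_monom3: "poly_fun (monom3 e) = mono_fun e"
  by (simp add: monom3_def poly_fun_Abs real_polynomial_function_mono_fun)

lemma coeff3_monom3: "coeff3 (monom3 e) = (\<lambda>f. if f = e then 1 else 0)"
  by (rule coeff3_eqI) (simp add: poly_fun_monom3 is_coeffs_mono)

text \<open>This characterises the inner product, since the monomials form a basis.\<close>

lemma inner_monom3: "inner (monom3 e) (monom3 f) = (if e = f then fact_exp e else 0)"
  by (subst inner_tpoly_superset [of "{e}"]) (auto simp: coeff3_monom3)

definition deg :: "nat^3 \<Rightarrow> nat"
  where "deg e = (\<Sum>i\<in>UNIV. e $ i)"

definition forms :: "nat \<Rightarrow> tpoly set"
  where "forms d = span {monom3 e | e. deg e = d}"

section \<open>The action of the general linear group and its differential\<close>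

definition act :: "real^3^3 \<Rightarrow> tpoly \<Rightarrow> tpoly"
  where "act g p = Abs_tpoly (\<lambda>u. poly_fun p (matrix_inv g *v u))"

lemma poly_fun_act: "poly_fun (act g p) u = poly_fun p (matrix_inv g *v u)"
proof -
  have "real_polynomial_function (poly_fun p o (\<lambda>u. matrix_inv g *v u))"
    by (intro real_polynomial_function_compose polynomial_function_bounded_linear
        real_polynomial_poly_fun) (simp add: matrix_vector_mul_bounded_linear)
  then show ?thesis
    by (simp add: act_def poly_fun_Abs o_def)
qed

text \<open>
  \<open>dact X p\<close> is \<open>\<pi>(X)p\<close>: the differential at the identity of the orbit map \<open>g \<mapsto> g \<cdot> p\<close>, applied
  to \<open>X\<close>. The invertible matrices form a neighbourhood of the identity, so the values of
  \<^const>\<open>act\<close> at singular matrices are irrelevant.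
\<close>

definition dact :: "real^3^3 \<Rightarrow> tpoly \<Rightarrow> tpoly"
  where "dact X p = frechet_derivative (\<lambda>g. act g p) (at (mat 1)) X"

section \<open>The moment map and its critical points\<close>

definition sym3 :: "(real^3^3) set"
  where "sym3 = {X. transpose X = X}"

definition tr_inner :: "real^3^3 \<Rightarrow> real^3^3 \<Rightarrow> real"
  where "tr_inner X Y = trace (X ** transpose Y)"

definition moment_map :: "tpoly \<Rightarrow> real^3^3"
  where "moment_map p = (THE M. M \<in> sym3 \<and>
    (\<forall>X\<in>sym3. tr_inner M X = inner (dact X p) p / (norm p)\<^sup>2))"

definition F_energy :: "tpoly \<Rightarrow> real"
  where "F_energy p = tr_inner (moment_map p) (moment_map p)"

text \<open>
  Critical points are those of \<^const>\<open>F_energy\<close> restricted to the open subset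
  \<open>forms d - {0}\<close> of the finite-dimensional space \<^term>\<open>forms d\<close>: the derivative
  is taken along \<^term>\<open>forms d\<close> only.
\<close>

definition is_critical :: "nat \<Rightarrow> tpoly \<Rightarrow> bool"
  where "is_critical d p \<longleftrightarrow> (F_energy has_derivative (\<lambda>_. 0)) (at p within forms d - {0})"

section \<open>Diagonal matrices, roots and weights\<close>

text \<open>
  The space \<open>\<aa>\<close> of diagonal matrices is represented by triples in \<open>real^3\<close>; the standard inner
  product of triples is the restriction of \<^const>\<open>tr_inner\<close> (lemma \<open>tr_inner_diag\<close>).
\<close>

definition diag :: "real^3 \<Rightarrow> real^3^3"
  where "diag a = (\<chi> i j. if i = j then a $ i else 0)"

lemma tr_inner_diag: "tr_inner (diag a) (diag b) = inner a b"
  by (simp add: tr_inner_def diag_def trace_def matrix_matrix_mult_def transpose_def inner_vec_def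
      sum_3)

definition a_plus :: "(real^3) set"
  where "a_plus = {a. a $ 1 < a $ 2 \<and> a $ 2 < a $ 3}"

definition roots :: "(real^3) set"
  where "roots = {axis i 1 - axis j 1 | i j. i \<noteq> j}"

definition weights :: "nat \<Rightarrow> (real^3) set"
  where "weights d = {- (\<chi> i. real (e $ i)) | e. deg e = d}"

definition mcc :: "(real^3) set \<Rightarrow> real^3"
  where "mcc \<Phi> = (THE v. v \<in> convex hull \<Phi> \<and> (\<forall>w\<in>convex hull \<Phi>. norm v \<le> norm w))"

section \<open>The stratifying set\<close>

definition Ad_orbit :: "real^3 \<Rightarrow> (real^3^3) set"
  where "Ad_orbit \<beta> = {k ** diag \<beta> ** matrix_inv k | k. orthogonal_matrix k}"

definition crit_set :: "nat \<Rightarrow> real^3 \<Rightarrow> tpoly set"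
  where "crit_set d \<beta> = {p \<in> forms d - {0}. is_critical d p \<and> moment_map p \<in> Ad_orbit \<beta>}"

definition stratifying_set :: "nat \<Rightarrow> (real^3) set"
  where "stratifying_set d = {\<beta> \<in> closure a_plus. crit_set d \<beta> \<noteq> {}}"

end

theory Submission
  imports Defs
begin

text \<open>
  For the given inner product, multiplication by a variable \<open>x\<^sub>i\<close> is adjoint to the partial derivative
  \<open>\<partial>\<^sub>i\<close> (\<open>inner_mul_var\<close>). Since \<open>\<pi>(X)p = - \<Sum> X\<^sub>k\<^sub>l x\<^sub>l \<partial>\<^sub>k p\<close>
  (\<open>dact_eq_polarize\<close>), the moment map has the entries
  \<open>m(p)\<^sub>k\<^sub>l = - \<langle>\<partial>\<^sub>k p, \<partial>\<^sub>l p\<rangle> / \<parallel>p\<parallel>\<^sup>2\<close> (\<open>moment_map_nth\<close>). The gradient of the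
  energy at \<open>p\<close> is a multiple of \<open>\<pi>(m(p))p - \<parallel>m(p)\<parallel>\<^sup>2 p\<close>, so \<open>p\<close> is critical if and only if it
  is an eigenvector of \<open>\<pi>(m(p))\<close> with eigenvalue \<open>\<parallel>m(p)\<parallel>\<^sup>2\<close> (\<open>is_critical_iff\<close>).

  Everything is equivariant under orthogonal substitutions, hence a critical \<open>p\<close> with \<open>m(p)\<close> in
  the orbit of \<open>\<beta>\<close> may be replaced by one with \<open>m(p) = \<beta>\<close> diagonal. In terms of coefficients
  this means three things (\<open>crit_set_nonempty_iff_coeff3\<close>): every weight \<open>\<alpha>\<close> of \<open>p\<close> lies on the
  plane \<open>\<langle>\<alpha>,\<beta>\<rangle> = \<parallel>\<beta>\<parallel>\<^sup>2\<close>, the barycentre of the weights with masses proportional to the squared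
  norms of the monomial terms is \<open>\<beta>\<close>, and \<open>\<langle>\<partial>\<^sub>k p, \<partial>\<^sub>l p\<rangle> = 0\<close> for \<open>k \<noteq> l\<close>. The last condition
  links two weights precisely when their difference is a root.

  From pairs to critical forms: if \<open>\<beta>\<close> is the shortest vector of the segment between two weights whose
  difference is not a root, then \<open>\<beta>\<close> is one of these weights and a monomial does it, or \<open>\<beta>\<close> is the
  foot of the perpendicular from the origin, and the sum of the two monomials, scaled so that the barycentre is
  \<open>\<beta>\<close>, satisfies the three conditions.

  From critical forms to pairs: all weights lie in the plane of vectors with coordinate sum \<open>-d\<close>. If
  the coordinates of \<open>\<beta>\<close> are not all equal, then the weights of \<open>p\<close> lie on a line through \<open>\<beta>\<close>
  perpendicular to \<open>\<beta>\<close>; take the two extreme ones. Were their difference a root, there would be no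
  lattice point strictly between them, \<open>p\<close> would consist of two monomials, and a single nonzero
  product would make some \<open>\<langle>\<partial>\<^sub>k p, \<partial>\<^sub>l p\<rangle>\<close> nonzero. If \<open>\<beta> = -(d/3)(1,1,1)\<close>, a suitable pair of
  weights exists for every \<open>d \<ge> 2\<close> whether or not it comes from \<open>p\<close>, and no linear form has this moment.
\<close>

section \<open>Expansion into monomials\<close>

text \<open>Exponents are shifted by \<open>axis i 1\<close>; rewriting this \<open>1\<close> to \<open>Suc 0\<close> would break the rules below.\<close>

declare One_nat_def [simp del]

lemma mono_fun_axis: "mono_fun (axis i 1) u = u $ i"
  using exhaust_3 [of i] by (auto simp: mono_fun_3 axis_def)

lemma linear_coeff3: "linear (\<lambda>p. coeff3 p e)"
  by (rule linearI) auto

lemma coeff3_diff [simp]: "coeff3 (p - q) e = coeff3 p e - coeff3 q e"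
  by (rule linear_diff [OF linear_coeff3])

lemma coeff3_uminus [simp]: "coeff3 (- p) e = - coeff3 p e"
  by (rule linear_neg [OF linear_coeff3])

lemma coeff3_sum [simp]: "coeff3 (\<Sum>i\<in>I. f i) e = (\<Sum>i\<in>I. coeff3 (f i) e)"
  by (rule linear_sum [OF linear_coeff3])

lemma coeff3_ext: "p = q" if "\<And>e. coeff3 p e = coeff3 q e"
  using coeff3_eq_0 [of "p - q"] that by (simp add: fun_eq_iff)

lemma monom_expansion:
  assumes "finite S" "{e. coeff3 p e \<noteq> 0} \<subseteq> S"
  shows "p = (\<Sum>e\<in>S. coeff3 p e *\<^sub>R monom3 e)"
proof (rule coeff3_ext)
  fix f
  show "coeff3 p f = coeff3 (\<Sum>e\<in>S. coeff3 p e *\<^sub>R monom3 e) f"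
    using assms by (auto simp: coeff3_monom3 if_distrib cong: if_cong)
qed

section \<open>Multiplication by a variable and partial derivatives\<close>

definition mul_var :: "3 \<Rightarrow> tpoly \<Rightarrow> tpoly"
  where "mul_var i p = Abs_tpoly (\<lambda>u. u $ i * poly_fun p u)"

lemma poly_fun_mul_var [simp]: "poly_fun (mul_var i p) u = u $ i * poly_fun p u"
  unfolding mul_var_def
  by (subst poly_fun_Abs)
    (auto intro!: real_polynomial_function.intros(4) real_polynomial_function_nth
      real_polynomial_poly_fun)

lemma linear_mul_var: "linear (mul_var i)"
  by (rule linearI) (auto simp: tpoly_eq_iff algebra_simps)

lemma mul_var_commute: "mul_var i (mul_var j p) = mul_var j (mul_var i p)"
  by (simp add: tpoly_eq_iff)

lemma mul_var_monom: "mul_var i (monom3 e) = monom3 (e + axis i 1)"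
  by (simp add: tpoly_eq_iff poly_fun_monom3 mono_fun_plus mono_fun_axis)

text \<open>
  Subtraction of exponents is truncated, so dividing by a variable and multiplying again gives back
  the monomial only if the variable occurs in it.
\<close>

lemma add_axis_eq_iff: "e + axis i 1 = f \<longleftrightarrow> f $ i > 0 \<and> e = f - axis i 1" for e f :: "nat^3"
  by (auto simp: vec_eq_iff axis_def)

lemma coeff3_mul_var:
  "coeff3 (mul_var i p) f = (if f $ i = 0 then 0 else coeff3 p (f - axis i 1))"
proof -
  have "mul_var i p = (\<Sum>e | coeff3 p e \<noteq> 0. coeff3 p e *\<^sub>R monom3 (e + axis i 1))"
    by (subst monom_expansion [OF finite_coeff3 subset_refl, of p])
      (simp add: linear_sum [OF linear_mul_var] linear_cmul [OF linear_mul_var] mul_var_monom)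
  then have "coeff3 (mul_var i p) f
      = (\<Sum>e | coeff3 p e \<noteq> 0. coeff3 p e * (if f = e + axis i 1 then 1 else 0))"
    by (simp add: coeff3_monom3)
  also have "\<dots> = (\<Sum>e | coeff3 p e \<noteq> 0. if e = f - axis i 1 then
      (if f $ i = 0 then 0 else coeff3 p e) else 0)"
  proof (intro sum.cong refl)
    fix e
    have "f = e + axis i 1 \<longleftrightarrow> f $ i > 0 \<and> e = f - axis i 1"
      using add_axis_eq_iff [of e i f] by metis
    then show "coeff3 p e * (if f = e + axis i 1 then 1 else 0)
        = (if e = f - axis i 1 then if f $ i = 0 then 0 else coeff3 p e else 0)"
      by (cases "f $ i = 0") simp_all
  qed
  also have "\<dots> = (if f $ i = 0 then 0 else coeff3 p (f - axis i 1))"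
    by (subst sum.delta) (auto simp: finite_coeff3)
  finally show ?thesis .
qed

text \<open>
  The formal partial derivative. Terms in which the variable is absent have a truncated exponent but the
  coefficient zero.
\<close>

definition pd :: "3 \<Rightarrow> tpoly \<Rightarrow> tpoly"
  where "pd i p = (\<Sum>e | coeff3 p e \<noteq> 0. (coeff3 p e * real (e $ i)) *\<^sub>R monom3 (e - axis i 1))"

lemma coeff3_pd: "coeff3 (pd i p) f = real (Suc (f $ i)) * coeff3 p (f + axis i 1)"
proof -
  have "coeff3 (pd i p) f = (\<Sum>e | coeff3 p e \<noteq> 0. if e = f + axis i 1 then
      real (Suc (f $ i)) * coeff3 p e else 0)"
    unfolding pd_def
  proof (subst coeff3_sum, intro sum.cong refl)
    fix e
    have *: "e = f + axis i 1 \<longleftrightarrow> e $ i > 0 \<and> f = e - axis i 1"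
      using add_axis_eq_iff [of f i e] by metis
    show "coeff3 ((coeff3 p e * real (e $ i)) *\<^sub>R monom3 (e - axis i 1)) f
        = (if e = f + axis i 1 then real (Suc (f $ i)) * coeff3 p e else 0)"
    proof (cases "e = f + axis i 1")
      case True
      moreover have "e $ i = Suc (f $ i)"
        using True by (simp add: axis_def)
      ultimately show ?thesis
        using * by (simp add: coeff3_monom3)
    next
      case False
      then have "e $ i = 0 \<or> f \<noteq> e - axis i 1"
        using * by auto
      then show ?thesis
        using False by (auto simp: coeff3_monom3)
    qed
  qed
  also have "\<dots> = real (Suc (f $ i)) * coeff3 p (f + axis i 1)"
    by (subst sum.delta) (auto simp: finite_coeff3)
  finally show ?thesis .
qed

lemma linear_pd: "linear (pd i)"
  by (rule linearI) (auto intro!: coeff3_ext simp: coeff3_pd algebra_simps)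

lemmas linear_op_simps = linear_add [OF linear_pd] linear_add [OF linear_mul_var]
  linear_cmul [OF linear_pd] linear_cmul [OF linear_mul_var]
  linear_sum [OF linear_pd] linear_sum [OF linear_mul_var]

lemma pd_one: "pd i (monom3 0) = 0"
  by (rule coeff3_ext) (auto simp: coeff3_pd coeff3_monom3 vec_eq_iff axis_def)

lemma pd_mul_var: "pd i (mul_var j p) = (if i = j then p else 0) + mul_var j (pd i p)"
proof (rule coeff3_ext)
  fix e
  show "coeff3 (pd i (mul_var j p)) e = coeff3 ((if i = j then p else 0) + mul_var j (pd i p)) e"
  proof (cases "i = j")
    case True
    moreover have "e + axis j 1 - axis j 1 = e" "e $ j > 0 \<Longrightarrow> e - axis j 1 + axis j 1 = e"
      by (auto simp: vec_eq_iff axis_def)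
    ultimately show ?thesis
      by (auto simp: coeff3_pd coeff3_mul_var axis_def algebra_simps)
  next
    case False
    moreover have "e $ j > 0 \<Longrightarrow> e - axis j 1 + axis i 1 = e + axis i 1 - axis j 1"
      using False by (auto simp: vec_eq_iff axis_def)
    ultimately show ?thesis
      by (auto simp: coeff3_pd coeff3_mul_var axis_def)
  qed
qed

lemma fact_exp_add_axis: "fact_exp (e + axis i 1) = real (Suc (e $ i)) * fact_exp e"
proof -
  have "fact_exp f = fact (f $ 1) * (fact (f $ 2) * fact (f $ 3))" for f
    unfolding fact_exp_def UNIV_3 by simp
  then show ?thesis
    using exhaust_3 [of i] by (elim disjE) (simp_all add: axis_def flip: Suc_eq_plus1)
qed

text \<open>
  This adjointness is what the weights \<open>d\<^sub>1! d\<^sub>2! d\<^sub>3!\<close> of the inner product are made for: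
  raising an exponent \<open>e\<^sub>i\<close> by one multiplies the factorial weight by \<open>e\<^sub>i + 1\<close>, the factor that
  differentiation produces.
\<close>

lemma inner_mul_var: "inner (mul_var i p) q = inner p (pd i q)"
proof -
  let ?S = "{e. coeff3 p e \<noteq> 0}"
  have inj: "inj_on (\<lambda>e :: nat^3. e + axis i 1) ?S"
    by (auto simp: inj_on_def)
  have "inner (mul_var i p) q = (\<Sum>e\<in>(\<lambda>e. e + axis i 1) ` ?S.
      fact_exp e * coeff3 (mul_var i p) e * coeff3 q e)"
  proof (rule inner_tpoly_superset)
    fix e assume "e \<notin> (\<lambda>e. e + axis i 1) ` ?S"
    moreover have "e $ i > 0 \<Longrightarrow> e = (e - axis i 1) + axis i 1"
      using add_axis_eq_iff [of "e - axis i 1" i e] by simp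
    ultimately have "e $ i > 0 \<Longrightarrow> coeff3 p (e - axis i 1) = 0"
      by blast
    then show "coeff3 (mul_var i p) e = 0 \<or> coeff3 q e = 0"
      by (simp add: coeff3_mul_var)
  qed (simp add: finite_coeff3)
  also have "\<dots> = (\<Sum>e\<in>?S. fact_exp e * coeff3 p e * coeff3 (pd i q) e)"
  proof (subst sum.reindex [OF inj], intro sum.cong refl)
    fix e :: "nat^3"
    have "e + axis i 1 - axis i 1 = e" "(e + axis i 1) $ i \<noteq> 0"
      by (auto simp: vec_eq_iff axis_def)
    then show "((\<lambda>e. fact_exp e * coeff3 (mul_var i p) e * coeff3 q e) \<circ> (\<lambda>e. e + axis i 1)) e
        = fact_exp e * coeff3 p e * coeff3 (pd i q) e"
      by (simp add: fact_exp_add_axis coeff3_mul_var coeff3_pd algebra_simps)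
  qed
  finally show ?thesis
    by (simp add: inner_tpoly_def)
qed

text \<open>
  Together with the commutation rules of \<open>mul_var\<close> with \<open>pd\<close> and \<open>subst\<close>, this induction
  replaces the calculus of several variables: no polynomial function is ever differentiated as a function.
\<close>

lemma tpoly_induct [case_names one mul add scale]:
  assumes one: "P (monom3 0)"
    and mul: "\<And>i p. P p \<Longrightarrow> P (mul_var i p)"
    and add: "\<And>p q. P p \<Longrightarrow> P q \<Longrightarrow> P (p + q)"
    and scale: "\<And>r p. P p \<Longrightarrow> P (r *\<^sub>R p)"
  shows "P p"
proof -
  have monom: "P (monom3 e)" for e
  proof (induction "deg e" arbitrary: e)
    case 0
    then have "e = 0"
      by (simp add: deg_def vec_eq_iff)
    then show ?case
      using one by simp
  next
    case (Suc n)
    then obtain i where "e $ i \<noteq> 0"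
      by (fastforce simp: deg_def)
    then have e: "(e - axis i 1) + axis i 1 = e"
      using add_axis_eq_iff [of "e - axis i 1" i e] by simp
    have "deg ((e - axis i 1) + axis i 1) = Suc (deg (e - axis i 1))"
      by (simp add: deg_def sum.distrib axis_def)
    then have "P (monom3 (e - axis i 1))"
      using Suc by (simp add: e)
    then show ?case
      using mul [of "monom3 (e - axis i 1)" i] by (simp add: mul_var_monom e)
  qed
  have zero: "P 0"
    using scale [OF one, of 0] by simp
  have "P (\<Sum>e\<in>S. c e *\<^sub>R monom3 e)" if "finite S" for S c
    using that by (induction S rule: finite_induct) (auto intro: zero add scale monom)
  then show ?thesis
    using monom_expansion [OF finite_coeff3 subset_refl, of p] finite_coeff3 by metis
qed

section \<open>Linear substitution\<close>

definition subst :: "real^3^3 \<Rightarrow> tpoly \<Rightarrow> tpoly"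
  where "subst M p = Abs_tpoly (\<lambda>u. poly_fun p (M *v u))"

lemma poly_fun_subst [simp]: "poly_fun (subst M p) u = poly_fun p (M *v u)"
proof -
  have "real_polynomial_function (poly_fun p o (\<lambda>u. M *v u))"
    by (intro real_polynomial_function_compose polynomial_function_bounded_linear
        real_polynomial_poly_fun) (simp add: matrix_vector_mul_bounded_linear)
  then show ?thesis
    by (simp add: subst_def poly_fun_Abs o_def)
qed

lemma act_eq_subst: "act g p = subst (matrix_inv g) p"
  by (simp add: tpoly_eq_iff poly_fun_act)

lemma linear_subst: "linear (subst M)"
  by (rule linearI) (auto simp: tpoly_eq_iff)

lemmas linear_subst_simps = linear_add [OF linear_subst] linear_cmul [OF linear_subst]
  linear_sum [OF linear_subst]

lemma subst_one: "subst M (monom3 0) = monom3 0"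
  by (simp add: tpoly_eq_iff poly_fun_monom3 mono_fun_def)

lemma subst_id: "subst (mat 1) p = p"
  by (simp add: tpoly_eq_iff)

lemma subst_subst: "subst M (subst N p) = subst (N ** M) p"
  by (simp add: tpoly_eq_iff matrix_vector_mul_assoc)

lemma poly_fun_sum [simp]: "poly_fun (\<Sum>i\<in>I. f i) u = (\<Sum>i\<in>I. poly_fun (f i) u)"
  by (induction I rule: infinite_finite_induct) auto

lemma subst_mul_var: "subst M (mul_var i p) = (\<Sum>j\<in>UNIV. M $ i $ j *\<^sub>R mul_var j (subst M p))"
  by (simp add: tpoly_eq_iff matrix_vector_mult_def sum_distrib_left sum_distrib_right mult_ac)

lemma scaleR_if_delta: "c *\<^sub>R (if P then x else 0) = (if P then c *\<^sub>R x else 0)"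
  for x :: "'a::real_vector"
  by simp

lemma pd_subst: "pd i (subst M p) = (\<Sum>j\<in>UNIV. M $ j $ i *\<^sub>R subst M (pd j p))"
proof (induction p rule: tpoly_induct)
  case one
  then show ?case
    by (simp add: subst_one pd_one linear_0 [OF linear_subst])
next
  case (mul j p)
  have "pd i (subst M (mul_var j p)) = (\<Sum>l\<in>UNIV. M $ j $ l *\<^sub>R
     ((if i = l then subst M p else 0) + mul_var l (\<Sum>k\<in>UNIV. M $ k $ i *\<^sub>R subst M (pd k p))))"
    by (simp add: subst_mul_var linear_op_simps pd_mul_var mul)
  also have "\<dots> = M $ j $ i *\<^sub>R subst M p +
      (\<Sum>l\<in>UNIV. \<Sum>k\<in>UNIV. (M $ j $ l * M $ k $ i) *\<^sub>R mul_var l (subst M (pd k p)))"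
    by (simp only: linear_op_simps scaleR_add_right sum.distrib scaleR_sum_right
        scaleR_if_delta scaleR_scaleR sum.delta' finite if_True UNIV_I)
  also have "(\<Sum>l\<in>UNIV. \<Sum>k\<in>UNIV. (M $ j $ l * M $ k $ i) *\<^sub>R mul_var l (subst M (pd k p)))
      = (\<Sum>k\<in>UNIV. M $ k $ i *\<^sub>R subst M (mul_var j (pd k p)))"
    by (subst sum.swap) (simp add: subst_mul_var scaleR_sum_right mult.commute)
  also have "M $ j $ i *\<^sub>R subst M p + \<dots> = (\<Sum>k\<in>UNIV. M $ k $ i *\<^sub>R subst M (pd k (mul_var j p)))"
    by (simp add: pd_mul_var linear_subst_simps scaleR_add_right sum.distrib
        if_distrib [of "subst M"] scaleR_if_delta linear_0 [OF linear_subst] cong: if_cong)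
  finally show ?case .
qed (simp_all add: linear_op_simps linear_subst_simps scaleR_add_right sum.distrib
    scaleR_sum_right mult.commute)

text \<open>
  Transposition is the adjoint of substitution. In the induction step, the factor \<open>x\<^sub>i\<close> on the left
  becomes a derivative on the right, and the chain rule \<open>pd_subst\<close> for \<open>M\<^sup>T\<close> matches the expansion
  \<open>subst_mul_var\<close> for \<open>M\<close>. Orthogonal substitutions are therefore isometries.
\<close>

lemma inner_subst: "inner (subst M p) q = inner p (subst (transpose M) q)"
proof (induction p arbitrary: q rule: tpoly_induct)
  case one
  have "inner (monom3 0) q = coeff3 q 0" for q
    by (subst inner_tpoly_superset [of "{0}"])
      (auto simp: coeff3_monom3 fact_exp_def)
  moreover have "coeff3 q 0 = poly_fun q 0" for q
  proof -
    have "poly_fun q 0 = (\<Sum>e | coeff3 q e \<noteq> 0. coeff3 q e * mono_fun e 0)"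
      using is_coeffs_coeff3 [of q] by (simp add: is_coeffs_def)
    also have "\<dots> = (\<Sum>e | coeff3 q e \<noteq> 0. if e = 0 then coeff3 q e else 0)"
      by (intro sum.cong) (auto simp: mono_fun_3 vec3_eq_iff)
    also have "\<dots> = coeff3 q 0"
      by (auto simp: finite_coeff3)
    finally show ?thesis by simp
  qed
  ultimately show ?case
    by (simp add: subst_one)
next
  case (mul i p)
  then show ?case
    by (simp add: subst_mul_var inner_sum_left inner_sum_right inner_mul_var pd_subst transpose_def)
qed (simp_all add: linear_subst_simps inner_add_left)

section \<open>Forms\<close>

lemma subspace_forms: "subspace (forms d)"
  by (simp add: forms_def subspace_span)

lemma forms_iff_coeff3: "p \<in> forms d \<longleftrightarrow> (\<forall>e. coeff3 p e \<noteq> 0 \<longrightarrow> deg e = d)"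
proof
  assume "p \<in> forms d"
  then show "\<forall>e. coeff3 p e \<noteq> 0 \<longrightarrow> deg e = d"
    unfolding forms_def
  proof (induction rule: span_induct)
    case base
    show ?case
      by (rule subspaceI, auto) (metis add.right_neutral)
  next
    case (step x)
    then show ?case
      by (auto simp: coeff3_monom3 split: if_splits)
  qed
next
  assume *: "\<forall>e. coeff3 p e \<noteq> 0 \<longrightarrow> deg e = d"
  have "(\<Sum>e | coeff3 p e \<noteq> 0. coeff3 p e *\<^sub>R monom3 e) \<in> forms d"
    unfolding forms_def by (intro span_sum span_scale span_base) (use * in auto)
  then show "p \<in> forms d"
    using monom_expansion [OF finite_coeff3 subset_refl, of p] by simp
qed

lemma coeff3_mul_var_pd_same: "coeff3 (mul_var i (pd i p)) e = real (e $ i) * coeff3 p e"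
proof (cases "e $ i = 0")
  case False
  then have "e - axis i 1 + axis i 1 = e"
    using add_axis_eq_iff [of "e - axis i 1" i e] by simp
  then show ?thesis
    using False by (simp add: coeff3_mul_var coeff3_pd axis_def)
qed (simp add: coeff3_mul_var)

lemma deg_eq_sum: "real (deg e) = (\<Sum>i\<in>UNIV. real (e $ i))"
  by (simp add: deg_def)

text \<open>
  Euler's identity characterises forms, because the operator has the eigenvalue \<open>deg e\<close> on each monomial.
  In this shape, being a form is visibly preserved by linear substitutions.
\<close>

lemma forms_iff_euler: "p \<in> forms d \<longleftrightarrow> (\<Sum>i\<in>UNIV. mul_var i (pd i p)) = real d *\<^sub>R p"
proof -
  let ?E = "\<Sum>i\<in>UNIV. mul_var i (pd i p)"
  have "coeff3 ?E e = real (deg e) * coeff3 p e" for e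
    by (simp add: coeff3_mul_var_pd_same deg_eq_sum sum_distrib_right)
  moreover have "?E = real d *\<^sub>R p \<longleftrightarrow> (\<forall>e. coeff3 ?E e = coeff3 (real d *\<^sub>R p) e)"
    using coeff3_ext by metis
  ultimately show ?thesis
    unfolding forms_iff_coeff3 by auto
qed

text \<open>
  Partial derivatives are unbounded on the space of all polynomials; Euler's identity bounds them on forms of
  a fixed degree, since \<open>\<Sum> \<parallel>\<partial>\<^sub>i p\<parallel>\<^sup>2 = \<langle>\<Sum> x\<^sub>i \<partial>\<^sub>i p, p\<rangle> = d \<parallel>p\<parallel>\<^sup>2\<close>.
\<close>

lemma norm_pd_le:
  assumes "p \<in> forms d"
  shows "norm (pd i p) \<le> sqrt (real d) * norm p"
proof -
  have "(norm (pd i p))\<^sup>2 \<le> (\<Sum>j\<in>UNIV. (norm (pd j p))\<^sup>2)"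
    by (rule member_le_sum) auto
  also have "\<dots> = inner (\<Sum>j\<in>UNIV. mul_var j (pd j p)) p"
    by (simp add: inner_sum_left inner_mul_var power2_norm_eq_inner)
  also have "\<dots> = real d * (norm p)\<^sup>2"
    using assms by (simp add: forms_iff_euler power2_norm_eq_inner)
  finally have "sqrt ((norm (pd i p))\<^sup>2) \<le> sqrt (real d * (norm p)\<^sup>2)"
    by (rule real_sqrt_le_mono)
  then show ?thesis
    by (simp add: real_sqrt_mult)
qed

section \<open>The infinitesimal action\<close>

text \<open>
  The derivative of \<open>M \<mapsto> p \<circ> M\<close> at the identity, so that \<open>\<pi>(X)\<close> is its negative. Its matrix
  entry \<open>X\<^sub>k\<^sub>l\<close> multiplies the polarization operator \<open>x\<^sub>l \<partial>\<^sub>k\<close>.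
\<close>

definition polarize :: "real^3^3 \<Rightarrow> tpoly \<Rightarrow> tpoly"
  where "polarize X p = (\<Sum>k\<in>UNIV. \<Sum>l\<in>UNIV. X $ k $ l *\<^sub>R mul_var l (pd k p))"

lemma inner_polarize: "inner (polarize X p) q = (\<Sum>k\<in>UNIV. \<Sum>l\<in>UNIV. X $ k $ l * inner (pd k p) (pd l q))"
  by (simp add: polarize_def inner_sum_left inner_mul_var)

lemma linear_polarize: "linear (polarize X)"
  unfolding polarize_def
  by (rule linearI) (simp_all add: linear_op_simps scaleR_add_right sum.distrib scaleR_sum_right mult.commute)

lemma polarize_uminus: "polarize (- X) p = - polarize X p"
  by (simp add: polarize_def sum_negf)

lemma polarize_one: "polarize X (monom3 0) = 0"
  by (simp add: polarize_def pd_one linear_0 [OF linear_mul_var])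

lemma polarize_mul_var:
  "polarize X (mul_var i p) = (\<Sum>l\<in>UNIV. X $ i $ l *\<^sub>R mul_var l p) + mul_var i (polarize X p)"
proof -
  have "polarize X (mul_var i p) =
      (\<Sum>k\<in>UNIV. \<Sum>l\<in>UNIV. X $ k $ l *\<^sub>R mul_var l (if k = i then p else 0)) +
      (\<Sum>k\<in>UNIV. \<Sum>l\<in>UNIV. X $ k $ l *\<^sub>R mul_var i (mul_var l (pd k p)))"
    by (simp add: polarize_def pd_mul_var linear_op_simps scaleR_add_right sum.distrib
        mul_var_commute [of i])
  also have "(\<Sum>k\<in>UNIV. \<Sum>l\<in>UNIV. X $ k $ l *\<^sub>R mul_var l (if k = i then p else 0))
      = (\<Sum>k\<in>UNIV. if k = i then \<Sum>l\<in>UNIV. X $ k $ l *\<^sub>R mul_var l p else 0)"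
    by (intro sum.cong) (auto simp: linear_0 [OF linear_mul_var])
  also have "\<dots> = (\<Sum>l\<in>UNIV. X $ i $ l *\<^sub>R mul_var l p)"
    by simp
  also have "(\<Sum>k\<in>UNIV. \<Sum>l\<in>UNIV. X $ k $ l *\<^sub>R mul_var i (mul_var l (pd k p)))
      = mul_var i (polarize X p)"
    by (simp add: polarize_def linear_op_simps)
  finally show ?thesis .
qed

text \<open>
  A map into polynomials whose values involve only finitely many fixed monomials may be differentiated
  coefficient by coefficient. The support condition matters because the ambient space has infinite dimension.
\<close>

lemma has_derivative_coeffwise:
  fixes f :: "'a::real_normed_vector \<Rightarrow> tpoly"
  assumes S: "finite S" "\<And>x e. e \<notin> S \<Longrightarrow> coeff3 (f x) e = 0" "\<And>x e. e \<notin> S \<Longrightarrow> coeff3 (f' x) e = 0"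
    and der: "\<And>e. ((\<lambda>x. coeff3 (f x) e) has_derivative (\<lambda>x. coeff3 (f' x) e)) (at x within T)"
  shows "(f has_derivative f') (at x within T)"
proof -
  have "f = (\<lambda>x. \<Sum>e\<in>S. coeff3 (f x) e *\<^sub>R monom3 e)" "f' = (\<lambda>x. \<Sum>e\<in>S. coeff3 (f' x) e *\<^sub>R monom3 e)"
    using S by (auto simp: fun_eq_iff intro!: monom_expansion)
  moreover have "((\<lambda>x. \<Sum>e\<in>S. coeff3 (f x) e *\<^sub>R monom3 e) has_derivative
      (\<lambda>x. \<Sum>e\<in>S. coeff3 (f' x) e *\<^sub>R monom3 e)) (at x within T)"
    by (intro has_derivative_sum has_derivative_scaleR_left der)
  ultimately show ?thesis
    by simp
qed

lemma subst_support: "\<exists>S. finite S \<and> (\<forall>M e. e \<notin> S \<longrightarrow> coeff3 (subst M p) e = 0)"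
proof (induction p rule: tpoly_induct)
  case one
  then show ?case
    by (intro exI [of _ "{0}"]) (simp add: subst_one coeff3_monom3)
next
  case (mul i p)
  then obtain S where S: "finite S" "\<And>M e. e \<notin> S \<Longrightarrow> coeff3 (subst M p) e = 0"
    by blast
  show ?case
  proof (intro exI conjI allI impI)
    show "finite (\<Union>j. (\<lambda>e. e + axis j 1) ` S)"
      using S by simp
    fix M e
    assume e: "e \<notin> (\<Union>j. (\<lambda>e. e + axis j 1) ` S)"
    have "coeff3 (mul_var j (subst M p)) e = 0" for j
    proof (cases "e $ j = 0")
      case False
      then have "e = (e - axis j 1) + axis j 1"
        using add_axis_eq_iff [of "e - axis j 1" j e] by simp
      then have "e - axis j 1 \<notin> S"
        using e by (metis UN_I UNIV_I image_eqI)
      then show ?thesis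
        using S by (simp add: coeff3_mul_var)
    qed (simp add: coeff3_mul_var)
    then show "coeff3 (subst M (mul_var i p)) e = 0"
      by (simp add: subst_mul_var)
  qed
next
  case (add p q)
  then obtain S T where "finite S" "\<And>M e. e \<notin> S \<Longrightarrow> coeff3 (subst M p) e = 0"
    "finite T" "\<And>M e. e \<notin> T \<Longrightarrow> coeff3 (subst M q) e = 0"
    by metis
  then show ?case
    by (intro exI [of _ "S \<union> T"]) (simp add: linear_subst_simps)
next
  case (scale r p)
  then show ?case
    by (auto simp: linear_subst_simps)
qed

lemma mat_1_nth: "mat 1 $ i $ j = (if i = j then 1 else 0)"
  by (simp add: mat_def)

text \<open>
  Coefficients of \<open>p \<circ> M\<close> are differentiated by induction on \<open>p\<close>: multiplication by a variable is not
  continuous on polynomials, but it only shifts coefficients.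
\<close>

lemma has_derivative_coeff3_subst:
  "((\<lambda>M. coeff3 (subst M p) e) has_derivative (\<lambda>X. coeff3 (polarize X p) e)) (at (mat 1))"
proof (induction p arbitrary: e rule: tpoly_induct)
  case one
  then show ?case
    by (simp add: subst_one polarize_one)
next
  case (mul i p)
  have 1: "((\<lambda>M. coeff3 (mul_var j (subst M p)) e) has_derivative
      (\<lambda>X. coeff3 (mul_var j (polarize X p)) e)) (at (mat 1))" for j
    using mul by (cases "e $ j = 0") (simp_all add: coeff3_mul_var)
  have "((\<lambda>M. M $ i $ j * coeff3 (mul_var j (subst M p)) e) has_derivative
      (\<lambda>X. mat 1 $ i $ j * coeff3 (mul_var j (polarize X p)) e
        + X $ i $ j * coeff3 (mul_var j (subst (mat 1) p)) e)) (at (mat 1))" for j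
    by (intro has_derivative_mult 1 bounded_linear_imp_has_derivative
        bounded_linear_compose [OF bounded_linear_vec_nth bounded_linear_vec_nth])
  then have "((\<lambda>M. \<Sum>j\<in>UNIV. M $ i $ j * coeff3 (mul_var j (subst M p)) e) has_derivative
      (\<lambda>X. \<Sum>j\<in>UNIV. mat 1 $ i $ j * coeff3 (mul_var j (polarize X p)) e
        + X $ i $ j * coeff3 (mul_var j (subst (mat 1) p)) e)) (at (mat 1))"
    by (rule has_derivative_sum)
  then show ?case
    by (simp add: subst_mul_var polarize_mul_var subst_id sum.distrib mat_1_nth
        if_distrib [of "\<lambda>x. x * _"] add.commute cong: if_cong)
qed (auto simp: linear_subst_simps linear_add [OF linear_polarize] linear_cmul [OF linear_polarize]
    intro!: has_derivative_add has_derivative_mult_right)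

lemma has_derivative_subst:
  "((\<lambda>M. subst M p) has_derivative (\<lambda>X. polarize X p)) (at (mat 1))"
proof -
  obtain S where S: "finite S" "\<And>M e. e \<notin> S \<Longrightarrow> coeff3 (subst M p) e = 0"
    using subst_support by blast
  moreover have "coeff3 (polarize X p) e = 0" if "e \<notin> S" for X e
  proof -
    have "((\<lambda>M :: real^3^3. 0 :: real) has_derivative (\<lambda>X. coeff3 (polarize X p) e)) (at (mat 1))"
      using has_derivative_coeff3_subst [of p e] S(2) [OF that] by simp
    then have "(\<lambda>X. coeff3 (polarize X p) e) = (\<lambda>X. 0)"
      by (rule has_derivative_unique) simp
    then show ?thesis
      by meson
  qed
  ultimately show ?thesis
    by (intro has_derivative_coeffwise [of S] has_derivative_coeff3_subst)
qed

lemma matrix_inv_eqI: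
  fixes A B :: "real^'n^'n"
  assumes "A ** B = mat 1" 
  shows "matrix_inv A = B"
proof -
  have BA: "B ** A = mat 1"
    using assms matrix_left_right_inverse by blast
  have "A ** matrix_inv A = mat 1 \<and> matrix_inv A ** A = mat 1"
    unfolding matrix_inv_def by (rule someI [of _ B]) (simp add: assms BA)
  then have "B ** (A ** matrix_inv A) = B"
    by simp
  then show ?thesis
    by (simp add: matrix_mul_assoc BA)
qed

text \<open>
  Both nontrivial derivatives below, of matrix inversion and of the quadratic forms
  \<open>\<langle>\<partial>\<^sub>k q, \<partial>\<^sub>l q\<rangle>\<close>, come with an explicit quadratic remainder.
\<close>

lemma has_derivative_quadratic_remainder:
  fixes f :: "'a::real_normed_vector \<Rightarrow> 'b::real_normed_vector"
  assumes "bounded_linear f'"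
    and "\<forall>\<^sub>F y in at x within S. norm (f y - f x - f' (y - x)) \<le> C * (norm (y - x))\<^sup>2"
  shows "(f has_derivative f') (at x within S)"
proof -
  have "((\<lambda>y. (1 / norm (y - x)) *\<^sub>R (f y - (f x + f' (y - x)))) \<longlongrightarrow> 0) (at x within S)"
  proof (rule Lim_null_comparison)
    show "\<forall>\<^sub>F y in at x within S. norm ((1 / norm (y - x)) *\<^sub>R (f y - (f x + f' (y - x)))) \<le> C * norm (y - x)"
      using assms(2)
    proof eventually_elim
      case (elim y)
      then show ?case
        by (cases "y = x") (simp_all add: divide_le_eq power2_eq_square diff_diff_eq mult.assoc)
    qed
    have "((\<lambda>y. C * norm (y - x)) \<longlongrightarrow> C * norm (x - x)) (at x within S)"
      by (intro tendsto_intros)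
    then show "((\<lambda>y. C * norm (y - x)) \<longlongrightarrow> 0) (at x within S)"
      by simp
  qed
  then show ?thesis
    using assms(1) by (simp add: has_derivative_within)
qed

lemma bounded_bilinear_matrix_mult: "bounded_bilinear ((**) :: real^'n^'m \<Rightarrow> real^'k^'n \<Rightarrow> real^'k^'m)"
  unfolding bilinear_conv_bounded_bilinear [symmetric]
  by (auto simp: bilinear_def vec_eq_iff matrix_matrix_mult_def sum.distrib distrib_left distrib_right
      sum_distrib_left mult_ac intro!: linearI)

text \<open>
  For \<open>g = 1 + h\<close> with inverse \<open>B\<close> one has \<open>B h = 1 - B\<close>, hence the remainder \<open>B - 1 + h\<close> equals
  \<open>B h h\<close>; the first equation also bounds \<open>B\<close> once \<open>h\<close> is small.
\<close>

lemma has_derivative_matrix_inv: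
  "((matrix_inv :: real^'n^'n \<Rightarrow> _) has_derivative uminus) (at (mat 1))"
proof -
  let ?I = "mat 1 :: real^'n^'n"
  interpret mm: bounded_bilinear "(**) :: real^'n^'n \<Rightarrow> real^'n^'n \<Rightarrow> real^'n^'n"
    by (rule bounded_bilinear_matrix_mult)
  obtain K where K: "K > 0" "\<And>(A :: real^'n^'n) (B :: real^'n^'n). norm (A ** B) \<le> norm A * norm B * K"
    using mm.pos_bounded by blast
  have inv: "matrix_inv ?I = ?I"
    by (rule matrix_inv_eqI) simp
  have "continuous_on UNIV (det :: real^'n^'n \<Rightarrow> real)"
    unfolding det_def by (intro continuous_intros)
  then have "isCont (det :: real^'n^'n \<Rightarrow> real) ?I"
    by (simp add: continuous_on_eq_continuous_at)
  then have "\<forall>\<^sub>F g :: real^'n^'n in at ?I. det g \<noteq> 0"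
    by (intro tendsto_imp_eventually_ne [of _ "det ?I"]) (simp_all add: isCont_def)
  moreover have "\<forall>\<^sub>F g in at ?I. dist g ?I < 1 / (2 * K)"
    using K by (intro tendstoD tendsto_ident_at) simp
  ultimately have "\<forall>\<^sub>F g in at ?I. norm (matrix_inv g - matrix_inv ?I - - (g - ?I))
      \<le> (2 * norm ?I * K\<^sup>2) * (norm (g - ?I))\<^sup>2"
  proof eventually_elim
    case (elim g)
    define h where "h = g - ?I"
    have hK: "norm h * K \<le> 1 / 2"
      using elim K by (simp add: h_def dist_norm field_simps)
    from elim obtain B where "g ** B = ?I"
      using invertible_det_nz invertible_right_inverse by blast
    then have B: "matrix_inv g = B" "B ** g = ?I"
      using matrix_left_right_inverse by (auto intro: matrix_inv_eqI)
    have Bh: "B ** h = ?I - B"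
      using B by (simp add: h_def mm.diff_right)
    have "norm B = norm (?I - B ** h)"
      by (simp add: Bh)
    also have "\<dots> \<le> norm ?I + norm B * norm h * K"
      using norm_triangle_ineq4 K(2) by (meson add_left_mono order_trans)
    also have "norm B * norm h * K \<le> norm B * (1 / 2)"
      using mult_left_mono [OF hK, of "norm B"] by (simp add: mult.assoc)
    finally have nB: "norm B \<le> 2 * norm ?I"
      by simp
    have "matrix_inv g - matrix_inv ?I - - (g - ?I) = B ** h ** h"
      unfolding Bh by (simp add: B inv mm.diff_left Bh) (simp add: h_def)
    also have "norm \<dots> \<le> norm B * norm h * K * norm h * K"
      using K(1) by (intro order_trans [OF K(2)] mult_right_mono K(2)) auto
    also have "\<dots> = norm B * ((norm h)\<^sup>2 * K\<^sup>2)"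
      by (simp add: power2_eq_square)
    also have "\<dots> \<le> 2 * norm ?I * ((norm h)\<^sup>2 * K\<^sup>2)"
      using nB by (intro mult_right_mono) auto
    finally show ?case
      by (simp add: h_def mult_ac)
  qed
  then show ?thesis
    by (intro has_derivative_quadratic_remainder bounded_linear_minus bounded_linear_ident) auto
qed

lemma dact_eq_polarize: "dact X p = - polarize X p"
proof -
  have "((\<lambda>g. act g p) has_derivative (\<lambda>X. polarize (- X) p)) (at (mat 1))"
    unfolding act_eq_subst
    using has_derivative_compose [OF has_derivative_matrix_inv, of "\<lambda>M. subst M p"
        "\<lambda>X. polarize X p"] has_derivative_subst [of p]
    by (simp add: matrix_inv_eqI [of "mat 1" "mat 1"])
  then show ?thesis
    unfolding dact_def using frechet_derivative_at by (metis polarize_uminus)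
qed

section \<open>The moment map\<close>

lemma tr_inner_eq_inner: "tr_inner X Y = inner X Y"
  by (simp add: tr_inner_def trace_def matrix_matrix_mult_def transpose_def inner_vec_def)

lemma moment_map_unique:
  assumes "M \<in> sym3" "\<And>X. X \<in> sym3 \<Longrightarrow> tr_inner M X = inner (dact X p) p / (norm p)\<^sup>2"
  shows "moment_map p = M"
  unfolding moment_map_def
proof (rule the_equality)
  fix M'
  assume M': "M' \<in> sym3 \<and> (\<forall>X\<in>sym3. tr_inner M' X = inner (dact X p) p / (norm p)\<^sup>2)"
  have "M' - M \<in> sym3"
    using assms(1) M' by (simp add: sym3_def transpose_def vec_eq_iff)
  then have "inner (M' - M) (M' - M) = 0"
    using assms(2) M' by (simp add: tr_inner_eq_inner inner_diff_left)
  then show "M' = M"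
    by simp
qed (use assms in blast)

text \<open>
  By adjointness \<open>\<langle>x\<^sub>l \<partial>\<^sub>k p, p\<rangle> = \<langle>\<partial>\<^sub>k p, \<partial>\<^sub>l p\<rangle>\<close>, which is symmetric in \<open>k\<close> and \<open>l\<close>. At \<open>p = 0\<close>
  both sides vanish by the convention on division by zero.
\<close>

lemma moment_map_eq: "moment_map p = (\<chi> k l. - inner (pd k p) (pd l p) / (norm p)\<^sup>2)"
proof (rule moment_map_unique)
  show "(\<chi> k l. - inner (pd k p) (pd l p) / (norm p)\<^sup>2) \<in> sym3"
    by (simp add: sym3_def transpose_def inner_commute)
  fix X :: "real^3^3"
  show "tr_inner (\<chi> k l. - inner (pd k p) (pd l p) / (norm p)\<^sup>2) X = inner (dact X p) p / (norm p)\<^sup>2"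
    by (simp add: tr_inner_eq_inner dact_eq_polarize inner_polarize inner_vec_def sum_divide_distrib
        sum_negf mult.commute)
qed

lemma moment_map_nth: "moment_map p $ k $ l = - inner (pd k p) (pd l p) / (norm p)\<^sup>2"
  by (simp add: moment_map_eq)

lemma F_energy_eq: "F_energy p = inner (moment_map p) (moment_map p)"
  by (simp add: F_energy_def tr_inner_eq_inner)

lemma inner_polarize_moment_map:
  assumes "p \<noteq> 0"
  shows "inner (polarize (moment_map p) p) p = - F_energy p * (norm p)\<^sup>2"
proof -
  have "inner (pd k p) (pd l p) = - (norm p)\<^sup>2 * moment_map p $ k $ l" for k l
    using assms by (simp add: moment_map_nth)
  then show ?thesis
    by (simp add: inner_polarize F_energy_eq inner_vec_def sum_negf sum_distrib_left mult_ac)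
qed

section \<open>The gradient of the energy\<close>

text \<open>
  The derivative is taken along forms only, where the quadratic remainder
  \<open>\<langle>\<partial>\<^sub>k v, \<partial>\<^sub>l v\<rangle>\<close> is bounded by \<open>d \<parallel>v\<parallel>\<^sup>2\<close>; the linear part, although built from unbounded operators, is
  an inner product with a fixed polynomial and hence bounded.
\<close>

lemma has_derivative_inner_pd:
  assumes "p \<in> forms d"
  shows "((\<lambda>q. inner (pd k q) (pd l q)) has_derivative
    (\<lambda>v. inner (mul_var k (pd l p) + mul_var l (pd k p)) v)) (at p within forms d - {0})"
proof (rule has_derivative_quadratic_remainder)
  have "norm (inner (pd k q) (pd l q) - inner (pd k p) (pd l p)
      - inner (mul_var k (pd l p) + mul_var l (pd k p)) (q - p)) \<le> real d * (norm (q - p))\<^sup>2"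
    if "q \<in> forms d" for q
  proof -
    have v: "q - p \<in> forms d"
      using that assms by (intro subspace_diff subspace_forms)
    have "inner (pd k q) (pd l q) - inner (pd k p) (pd l p)
      - inner (mul_var k (pd l p) + mul_var l (pd k p)) (q - p)
      = inner (pd k (q - p)) (pd l (q - p))"
      using inner_commute [of "pd l p" "pd k q"] inner_commute [of "pd l p" "pd k p"]
      by (simp add: inner_add_left inner_mul_var linear_diff [OF linear_pd] inner_diff_left
          inner_diff_right)
    also have "norm \<dots> \<le> norm (pd k (q - p)) * norm (pd l (q - p))"
      by (simp add: Cauchy_Schwarz_ineq2)
    also have "\<dots> \<le> (sqrt (real d) * norm (q - p)) * (sqrt (real d) * norm (q - p))"
      by (intro mult_mono norm_pd_le v) auto
    also have "\<dots> = real d * (norm (q - p))\<^sup>2"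
      by (simp add: power2_eq_square)
    finally show ?thesis .
  qed
  then show "\<forall>\<^sub>F q in at p within forms d - {0}. norm (inner (pd k q) (pd l q) - inner (pd k p) (pd l p)
      - inner (mul_var k (pd l p) + mul_var l (pd k p)) (q - p)) \<le> real d * (norm (q - p))\<^sup>2"
    by (auto simp: eventually_at_filter)
qed (rule bounded_linear_inner_right)

lemma has_derivative_F_energy:
  assumes "p \<in> forms d" "p \<noteq> 0"
  shows "(F_energy has_derivative
    (\<lambda>v. - 4 / (norm p)\<^sup>2 * inner (polarize (moment_map p) p + F_energy p *\<^sub>R p) v))
    (at p within forms d - {0})"
proof -
  define N where "N = inner p p"
  have N: "N \<noteq> 0" "(norm p)\<^sup>2 = N"
    using assms by (auto simp: N_def power2_norm_eq_inner)
  let ?c = "\<lambda>k l. inner (pd k p) (pd l p)"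
  let ?c' = "\<lambda>k l v. inner (mul_var k (pd l p) + mul_var l (pd k p)) v"
  have F: "F_energy = (\<lambda>q. (\<Sum>k\<in>UNIV. \<Sum>l\<in>UNIV. (inner (pd k q) (pd l q))\<^sup>2) * inverse ((inner q q)\<^sup>2))"
    by (simp add: fun_eq_iff F_energy_eq inner_vec_def moment_map_nth power2_eq_square
        sum_distrib_left power2_norm_eq_inner [unfolded power2_eq_square] divide_inverse mult_ac)
  have "((\<lambda>q. (inner (pd k q) (pd l q))\<^sup>2) has_derivative (\<lambda>v. 2 * ?c k l * ?c' k l v))
      (at p within forms d - {0})" for k l
    using has_derivative_power [OF has_derivative_inner_pd [OF assms(1)], of k l 2]
    by (simp add: mult_ac)
  then have num: "((\<lambda>q. \<Sum>k\<in>UNIV. \<Sum>l\<in>UNIV. (inner (pd k q) (pd l q))\<^sup>2) has_derivative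
      (\<lambda>v. \<Sum>k\<in>UNIV. \<Sum>l\<in>UNIV. 2 * ?c k l * ?c' k l v)) (at p within forms d - {0})"
    by (intro has_derivative_sum)
  have "((\<lambda>q. inner q q) has_derivative (\<lambda>v. inner p v + inner v p)) (at p within forms d - {0})"
    by (intro has_derivative_inner has_derivative_ident)
  from has_derivative_power [OF this, of 2]
  have "((\<lambda>q. (inner q q)\<^sup>2) has_derivative (\<lambda>v. 4 * N * inner p v)) (at p within forms d - {0})"
    by (simp add: N_def inner_commute mult_ac)
  from Deriv.has_derivative_inverse [OF _ this] have den: "((\<lambda>q. inverse ((inner q q)\<^sup>2)) has_derivative
      (\<lambda>v. - (inverse (N\<^sup>2) * (4 * N * inner p v) * inverse (N\<^sup>2)))) (at p within forms d - {0})"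
    using N by (simp add: N_def)
  have "(F_energy has_derivative (\<lambda>v.
      (\<Sum>k\<in>UNIV. \<Sum>l\<in>UNIV. (?c k l)\<^sup>2) * (- (inverse (N\<^sup>2) * (4 * N * inner p v) * inverse (N\<^sup>2)))
      + (\<Sum>k\<in>UNIV. \<Sum>l\<in>UNIV. 2 * ?c k l * ?c' k l v) * inverse (N\<^sup>2))) (at p within forms d - {0})"
    unfolding F using has_derivative_mult [OF num den] by (simp only: N_def)
  moreover have "(\<Sum>k\<in>UNIV. \<Sum>l\<in>UNIV. 2 * ?c k l * ?c' k l v)
      = - 4 * N * inner (polarize (moment_map p) p) v" for v
  proof -
    have "(\<Sum>k\<in>UNIV. \<Sum>l\<in>UNIV. ?c k l * inner (pd l p) (pd k v)) =
          (\<Sum>k\<in>UNIV. \<Sum>l\<in>UNIV. ?c k l * inner (pd k p) (pd l v))"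
      by (subst sum.swap) (simp add: inner_commute)
    then have "(\<Sum>k\<in>UNIV. \<Sum>l\<in>UNIV. 2 * ?c k l * ?c' k l v)
        = 4 * (\<Sum>k\<in>UNIV. \<Sum>l\<in>UNIV. ?c k l * inner (pd k p) (pd l v))"
      by (simp add: inner_add_left inner_mul_var distrib_left sum.distrib mult.assoc
          flip: sum_distrib_left)
    also have "\<dots> = - 4 * N * inner (polarize (moment_map p) p) v"
      using N by (simp add: inner_polarize moment_map_nth sum_negf flip: sum_divide_distrib)
    finally show ?thesis .
  qed
  moreover have "(\<Sum>k\<in>UNIV. \<Sum>l\<in>UNIV. (?c k l)\<^sup>2) = F_energy p * N\<^sup>2"
    using N by (simp add: F N_def)
  ultimately have "(F_energy has_derivative (\<lambda>v.
      F_energy p * N\<^sup>2 * (- (inverse (N\<^sup>2) * (4 * N * inner p v) * inverse (N\<^sup>2)))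
      + (- 4 * N * inner (polarize (moment_map p) p) v) * inverse (N\<^sup>2))) (at p within forms d - {0})"
    by (simp only:)
  moreover have "F_energy p * N\<^sup>2 * (- (inverse (N\<^sup>2) * (4 * N * a) * inverse (N\<^sup>2)))
      + (- 4 * N * b) * inverse (N\<^sup>2) = - 4 / N * (b + F_energy p * a)" for a b
    using N by (simp add: field_simps power2_eq_square)
  ultimately show ?thesis
    by (simp only: N(2) inner_add_left inner_scaleR_left)
qed

lemma deg_add_axis: "deg (e + axis i 1) = deg e + 1"
  by (simp add: deg_def sum.distrib axis_def)

text \<open>
  The gradient is itself a form, so the derivative can be tested in its own direction; a vanishing
  derivative then forces it to vanish. Recall that \<open>polarize\<close> is the negative of the infinitesimal action.
\<close>

lemma is_critical_iff:
  assumes p: "p \<in> forms d" "p \<noteq> 0"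
  shows "is_critical d p \<longleftrightarrow> polarize (moment_map p) p = - F_energy p *\<^sub>R p"
proof
  define w where "w = polarize (moment_map p) p + F_energy p *\<^sub>R p"
  let ?D = "\<lambda>v. - 4 / (norm p)\<^sup>2 * inner w v"
  note D = has_derivative_F_energy [OF p, folded w_def]
  show "is_critical d p" if "polarize (moment_map p) p = - F_energy p *\<^sub>R p"
    using D that by (simp add: is_critical_def w_def)
  assume crit: "is_critical d p"
  have w_forms: "w \<in> forms d"
  proof -
    have "mul_var l (pd k p) \<in> forms d" for k l
      unfolding forms_iff_coeff3
    proof (intro allI impI)
      fix e
      assume "coeff3 (mul_var l (pd k p)) e \<noteq> 0"
      then have e: "e $ l \<noteq> 0" "coeff3 p (e - axis l 1 + axis k 1) \<noteq> 0"
        by (auto simp: coeff3_mul_var coeff3_pd split: if_splits)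
      then have "(e - axis l 1) + axis l 1 = e"
        using add_axis_eq_iff [of "e - axis l 1" l e] by simp
      then have "deg e = deg (e - axis l 1) + 1"
        by (metis deg_add_axis)
      also have "\<dots> = deg (e - axis l 1 + axis k 1)"
        by (simp add: deg_add_axis)
      also have "\<dots> = d"
        using p e by (simp add: forms_iff_coeff3)
      finally show "deg e = d" .
    qed
    then show ?thesis
      unfolding w_def polarize_def
      by (intro subspace_add subspace_sum subspace_scale subspace_forms p)
  qed
  \<comment> \<open>The line through p in the direction w stays among nonzero forms near the parameter 0.\<close>
  define T where "T = {t :: real. p + t *\<^sub>R w \<noteq> 0}"
  have "open T"
    unfolding T_def by (intro open_Collect_neq continuous_intros)
  moreover have "0 \<in> T"
    using p by (simp add: T_def)
  ultimately have T: "at 0 within T = at 0"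
    by (metis at_within_open)
  have "p + t *\<^sub>R w \<in> forms d" for t
    by (intro subspace_add subspace_scale subspace_forms p w_forms)
  then have sub: "(\<lambda>t. p + t *\<^sub>R w) ` T \<subseteq> forms d - {0}"
    by (auto simp: T_def)
  have line: "((\<lambda>t. p + t *\<^sub>R w) has_derivative (\<lambda>t. t *\<^sub>R w)) (at 0 within T)"
    by (auto intro!: derivative_eq_intros)
  have "((\<lambda>t. F_energy (p + t *\<^sub>R w)) has_derivative (\<lambda>t. D' (t *\<^sub>R w))) (at 0)"
    if "(F_energy has_derivative D') (at p within forms d - {0})" for D'
    using has_derivative_in_compose [OF line has_derivative_subset [OF _ sub], of F_energy D'] that
    by (simp add: T)
  from this [OF D] this [OF crit [unfolded is_critical_def]]
  have "(\<lambda>t. ?D (t *\<^sub>R w)) = (\<lambda>t. 0)"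
    by (rule has_derivative_unique)
  then have "?D (1 *\<^sub>R w) = 0"
    by meson
  then have "w = 0"
    using p by simp
  then show "polarize (moment_map p) p = - F_energy p *\<^sub>R p"
    by (simp add: w_def add_eq_0_iff2)
qed

section \<open>Orthogonal equivariance\<close>

text \<open>
  With \<open>X = M\<inverse> Y M\<close> this is equivariance of the infinitesimal action; with \<open>X = Y = 1\<close> it says
  that Euler's operator commutes with substitution, also for singular \<open>M\<close>.
\<close>

lemma polarize_subst:
  assumes "M ** X = Y ** M"
  shows "polarize X (subst M p) = subst M (polarize Y p)"
proof -
  have "polarize X (subst M p) = (\<Sum>k\<in>UNIV. \<Sum>l\<in>UNIV. \<Sum>j\<in>UNIV.
      (M $ j $ k * X $ k $ l) *\<^sub>R mul_var l (subst M (pd j p)))"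
    by (simp add: polarize_def pd_subst linear_op_simps scaleR_sum_right mult.commute)
  also have "\<dots> = (\<Sum>l\<in>UNIV. \<Sum>j\<in>UNIV. \<Sum>k\<in>UNIV. (M $ j $ k * X $ k $ l) *\<^sub>R mul_var l (subst M (pd j p)))"
    by (subst sum.swap) (intro sum.cong refl sum.swap)
  also have "\<dots> = (\<Sum>l\<in>UNIV. \<Sum>j\<in>UNIV. (M ** X) $ j $ l *\<^sub>R mul_var l (subst M (pd j p)))"
    by (simp add: matrix_matrix_mult_def scaleR_sum_left)
  also have "\<dots> = (\<Sum>l\<in>UNIV. \<Sum>j\<in>UNIV. \<Sum>i\<in>UNIV. (Y $ j $ i * M $ i $ l) *\<^sub>R mul_var l (subst M (pd j p)))"
    unfolding assms by (simp add: matrix_matrix_mult_def scaleR_sum_left)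
  also have "\<dots> = (\<Sum>j\<in>UNIV. \<Sum>i\<in>UNIV. \<Sum>l\<in>UNIV. (Y $ j $ i * M $ i $ l) *\<^sub>R mul_var l (subst M (pd j p)))"
    by (subst sum.swap) (intro sum.cong refl sum.swap)
  also have "\<dots> = subst M (polarize Y p)"
    by (simp add: polarize_def linear_subst_simps subst_mul_var scaleR_sum_right)
  finally show ?thesis .
qed

lemma polarize_mat_1: "polarize (mat 1) p = (\<Sum>i\<in>UNIV. mul_var i (pd i p))"
  by (simp add: polarize_def mat_1_nth if_distrib [of "\<lambda>x. x *\<^sub>R _"] cong: if_cong)

lemma subst_in_forms: "p \<in> forms d \<Longrightarrow> subst M p \<in> forms d"
  unfolding forms_iff_euler polarize_mat_1 [symmetric]
  by (subst polarize_subst [of M "mat 1" "mat 1"]) (simp_all add: linear_subst_simps)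

lemma inner_subst_orthogonal:
  assumes "orthogonal_matrix k"
  shows "inner (subst k p) (subst k q) = inner p q"
  using assms by (simp add: inner_subst subst_subst orthogonal_matrix_def subst_id)

lemma moment_map_subst:
  assumes "orthogonal_matrix k"
  shows "moment_map (subst k p) = transpose k ** moment_map p ** k"
proof -
  have "norm (subst k p) = norm p"
    using inner_subst_orthogonal [OF assms] by (simp add: norm_eq_sqrt_inner)
  moreover have "inner (pd i (subst k p)) (pd l (subst k p))
      = (\<Sum>j\<in>UNIV. \<Sum>h\<in>UNIV. k $ h $ i * inner (pd h p) (pd j p) * k $ j $ l)" for i l
    by (simp add: pd_subst inner_sum_left inner_sum_right inner_subst_orthogonal [OF assms] 
        mult_ac sum_distrib_left sum_distrib_right)
  ultimately show ?thesis
    by (simp add: vec_eq_iff moment_map_nth matrix_matrix_mult_def transpose_def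
        sum_distrib_left sum_distrib_right sum_divide_distrib sum_negf mult_ac)
qed

text \<open>
  An orthogonal substitution moves the moment of a critical form to the diagonal matrix. Pairing the
  transported eigenvector equation with the form identifies the eigenvalue as \<open>\<langle>\<beta>,\<beta>\<rangle>\<close>.
\<close>

lemma crit_set_nonempty_iff:
  "crit_set d \<beta> \<noteq> {} \<longleftrightarrow>
    (\<exists>q\<in>forms d - {0}. moment_map q = diag \<beta> \<and> polarize (diag \<beta>) q = - inner \<beta> \<beta> *\<^sub>R q)"
proof
  assume "crit_set d \<beta> \<noteq> {}"
  then obtain p k where p: "p \<in> forms d" "p \<noteq> 0" "is_critical d p"
    and k: "orthogonal_matrix k" "moment_map p = k ** diag \<beta> ** matrix_inv k"
    unfolding crit_set_def Ad_orbit_def by blast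
  have ki: "matrix_inv k = transpose k" and kk: "k ** transpose k = mat 1" "transpose k ** k = mat 1"
    using k(1) by (auto simp: orthogonal_matrix_def intro: matrix_inv_eqI)
  have mk: "moment_map p ** k = k ** diag \<beta>"
    by (simp add: k(2) ki kk flip: matrix_mul_assoc)
  define q where "q = subst k p"
  have m: "moment_map q = diag \<beta>"
    by (simp add: q_def moment_map_subst [OF k(1)] mk kk matrix_mul_assoc flip: matrix_mul_assoc [of _ _ k])
  have q0: "q \<noteq> 0"
    using p inner_subst_orthogonal [OF k(1), of p p] by (auto simp: q_def)
  have "polarize (diag \<beta>) q = subst k (polarize (moment_map p) p)"
    unfolding q_def by (rule polarize_subst) (simp add: mk)
  also have "\<dots> = - F_energy p *\<^sub>R q"
    using p by (simp add: is_critical_iff q_def linear_cmul [OF linear_subst] linear_neg [OF linear_subst])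
  finally have eig: "polarize (diag \<beta>) q = - F_energy p *\<^sub>R q" .
  have "F_energy q = inner \<beta> \<beta>"
    by (simp add: F_energy_def m tr_inner_diag)
  moreover have "F_energy p = F_energy q"
    using inner_polarize_moment_map [OF q0] q0 by (simp add: m eig power2_norm_eq_inner)
  ultimately show "\<exists>q\<in>forms d - {0}. moment_map q = diag \<beta> \<and> polarize (diag \<beta>) q = - inner \<beta> \<beta> *\<^sub>R q"
    using q0 m eig subst_in_forms [OF p(1)] by (metis DiffI q_def singletonD)
next
  assume "\<exists>q\<in>forms d - {0}. moment_map q = diag \<beta> \<and> polarize (diag \<beta>) q = - inner \<beta> \<beta> *\<^sub>R q"
  then obtain q where q: "q \<in> forms d" "q \<noteq> 0" "moment_map q = diag \<beta>"
    "polarize (diag \<beta>) q = - inner \<beta> \<beta> *\<^sub>R q"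
    by blast
  have "is_critical d q"
    using q by (simp add: is_critical_iff F_energy_def tr_inner_diag)
  moreover have "diag \<beta> \<in> Ad_orbit \<beta>"
    unfolding Ad_orbit_def
    by (intro CollectI exI [of _ "mat 1"])
      (simp add: orthogonal_matrix_id matrix_inv_eqI [of "mat 1" "mat 1"])
  ultimately show "crit_set d \<beta> \<noteq> {}"
    using q by (auto simp: crit_set_def)
qed

section \<open>Critical forms in terms of coefficients\<close>

definition weight :: "nat^3 \<Rightarrow> real^3"
  where "weight e = - (\<chi> i. real (e $ i))"

lemma weight_nth: "weight e $ i = - real (e $ i)"
  by (simp add: weight_def)

lemma weights_eq: "weights d = weight ` {e. deg e = d}"
  by (auto simp: weights_def weight_def)

lemma weight_inject: "weight e = weight f \<longleftrightarrow> e = f"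
  by (simp add: vec_eq_iff weight_nth)

lemma weight_add_axis: "weight (e + axis i 1) = weight e - axis i 1"
  by (simp add: vec_eq_iff weight_nth axis_def)

lemma sum_weight: "(\<Sum>i\<in>UNIV. weight e $ i) = - real (deg e)"
  by (simp add: weight_nth deg_eq_sum sum_negf)

text \<open>
  The share of the squared norm carried by a monomial term. These are the coefficients that express the
  diagonal of the moment map as a convex combination of weights.
\<close>

definition mass :: "tpoly \<Rightarrow> nat^3 \<Rightarrow> real"
  where "mass q e = fact_exp e * (coeff3 q e)\<^sup>2 / (norm q)\<^sup>2"

lemma mass_nonneg: "mass q e \<ge> 0"
  using fact_exp_pos [of e] by (simp add: mass_def)

lemma norm_squared_eq: "(norm q)\<^sup>2 = (\<Sum>e | coeff3 q e \<noteq> 0. fact_exp e * (coeff3 q e)\<^sup>2)"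
  unfolding power2_norm_eq_inner inner_tpoly_def by (simp add: power2_eq_square mult.assoc)

lemma sum_mass: "q \<noteq> 0 \<Longrightarrow> (\<Sum>e | coeff3 q e \<noteq> 0. mass q e) = 1"
  by (simp add: mass_def norm_squared_eq [symmetric] flip: sum_divide_distrib)

lemma moment_map_diagonal:
  "moment_map q $ k $ k = (\<Sum>e | coeff3 q e \<noteq> 0. mass q e *\<^sub>R weight e) $ k"
proof -
  have "inner (pd k q) (pd k q) = inner q (mul_var k (pd k q))"
    by (metis inner_commute inner_mul_var)
  also have "\<dots> = (\<Sum>e | coeff3 q e \<noteq> 0. fact_exp e * (coeff3 q e)\<^sup>2 * real (e $ k))"
    by (simp add: inner_tpoly_def coeff3_mul_var_pd_same power2_eq_square mult_ac)
  finally show ?thesis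
    by (simp add: moment_map_nth mass_def weight_nth sum_divide_distrib sum_negf)
qed

lemma polarize_diag_eigen_iff:
  "polarize (diag \<beta>) q = - c *\<^sub>R q \<longleftrightarrow> (\<forall>e. coeff3 q e \<noteq> 0 \<longrightarrow> inner (weight e) \<beta> = c)"
proof -
  have "polarize (diag \<beta>) q = (\<Sum>k\<in>UNIV. \<beta> $ k *\<^sub>R mul_var k (pd k q))"
    by (simp add: polarize_def diag_def if_distrib [of "\<lambda>x. x *\<^sub>R _"] cong: if_cong)
  then have "coeff3 (polarize (diag \<beta>) q) e = - inner (weight e) \<beta> * coeff3 q e" for e
    by (simp add: coeff3_mul_var_pd_same inner_vec_def weight_nth sum_distrib_left sum_negf mult_ac)
  moreover have "polarize (diag \<beta>) q = - c *\<^sub>R q \<longleftrightarrow>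
      (\<forall>e. coeff3 (polarize (diag \<beta>) q) e = coeff3 (- c *\<^sub>R q) e)"
    using coeff3_ext by metis
  ultimately show ?thesis
    by auto
qed

lemma crit_set_nonempty_iff_coeff3:
  "crit_set d \<beta> \<noteq> {} \<longleftrightarrow> (\<exists>q\<in>forms d - {0}.
    (\<forall>e. coeff3 q e \<noteq> 0 \<longrightarrow> inner (weight e) \<beta> = inner \<beta> \<beta>) \<and>
    (\<Sum>e | coeff3 q e \<noteq> 0. mass q e *\<^sub>R weight e) = \<beta> \<and>
    (\<forall>k l. k \<noteq> l \<longrightarrow> inner (pd k q) (pd l q) = 0))"
proof -
  have "moment_map q = diag \<beta> \<longleftrightarrow> (\<Sum>e | coeff3 q e \<noteq> 0. mass q e *\<^sub>R weight e) = \<beta> \<and>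
      (\<forall>k l. k \<noteq> l \<longrightarrow> inner (pd k q) (pd l q) = 0)" if "q \<noteq> 0" for q
  proof -
    let ?B = "\<Sum>e | coeff3 q e \<noteq> 0. mass q e *\<^sub>R weight e"
    have "moment_map q = diag \<beta> \<longleftrightarrow> (\<forall>k. moment_map q $ k $ k = \<beta> $ k) \<and>
        (\<forall>k l. k \<noteq> l \<longrightarrow> moment_map q $ k $ l = 0)"
      by (auto simp: vec_eq_iff diag_def)
    also have "(\<forall>k. moment_map q $ k $ k = \<beta> $ k) \<longleftrightarrow> ?B = \<beta>"
      unfolding moment_map_diagonal by (simp add: vec_eq_iff)
    also have "(\<forall>k l. k \<noteq> l \<longrightarrow> moment_map q $ k $ l = 0) \<longleftrightarrow>
        (\<forall>k l. k \<noteq> l \<longrightarrow> inner (pd k q) (pd l q) = 0)"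
      using that by (simp add: moment_map_nth)
    finally show ?thesis .
  qed
  then show ?thesis
    unfolding crit_set_nonempty_iff polarize_diag_eigen_iff by auto
qed

section \<open>Roots and mixed second moments\<close>

lemma zero_notin_roots: "0 \<notin> roots"
proof
  assume "0 \<in> roots"
  then obtain i j :: 3 where "i \<noteq> j" "axis i 1 = (axis j 1 :: real^3)"
    by (auto simp: roots_def)
  then show False
    by (simp add: axis_eq_axis)
qed

text \<open>
  A monomial common to \<open>\<partial>\<^sub>k q\<close> and \<open>\<partial>\<^sub>l q\<close> comes from two monomials of \<open>q\<close> that arise from it by
  multiplication with \<open>x\<^sub>k\<close> and \<open>x\<^sub>l\<close>, so their weights differ by a root.
\<close>

lemma inner_pd_eq_0:
  assumes "\<And>e f. coeff3 q e \<noteq> 0 \<Longrightarrow> coeff3 q f \<noteq> 0 \<Longrightarrow> weight f - weight e \<notin> roots"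
    and "k \<noteq> l"
  shows "inner (pd k q) (pd l q) = 0"
proof -
  have "coeff3 (pd k q) g = 0 \<or> coeff3 (pd l q) g = 0" for g
  proof (rule ccontr)
    assume "\<not> ?thesis"
    then have "coeff3 q (g + axis k 1) \<noteq> 0" "coeff3 q (g + axis l 1) \<noteq> 0"
      by (auto simp: coeff3_pd)
    moreover have "weight (g + axis l 1) - weight (g + axis k 1) \<in> roots"
      using \<open>k \<noteq> l\<close> by (auto simp: weight_add_axis roots_def)
    ultimately show False
      using assms(1) by blast
  qed
  then show ?thesis
    by (subst inner_tpoly_superset [of "{}"]) auto
qed

text \<open>
  The converse mechanism: if only one monomial is common to both derivatives, nothing can cancel.
\<close>

lemma inner_pd_single:
  assumes "\<And>f. f \<noteq> g \<Longrightarrow> coeff3 q (f + axis k 1) = 0 \<or> coeff3 q (f + axis l 1) = 0"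
    and "coeff3 q (g + axis k 1) \<noteq> 0" "coeff3 q (g + axis l 1) \<noteq> 0"
  shows "inner (pd k q) (pd l q) \<noteq> 0"
proof -
  have "inner (pd k q) (pd l q) = fact_exp g * coeff3 (pd k q) g * coeff3 (pd l q) g"
    by (subst inner_tpoly_superset [of "{g}"]) (use assms(1) in \<open>auto simp: coeff3_pd\<close>)
  then show ?thesis
    using assms(2,3) fact_exp_pos [of g] by (simp add: coeff3_pd)
qed

section \<open>The vector of minimal norm\<close>

text \<open>
  The hull lies in the half space \<open>\<langle>\<beta>,w\<rangle> \<ge> \<parallel>\<beta>\<parallel>\<^sup>2\<close>, so that
  \<open>\<parallel>w - \<beta>\<parallel>\<^sup>2 \<le> \<parallel>w\<parallel>\<^sup>2 - \<parallel>\<beta>\<parallel>\<^sup>2\<close> on it, which gives minimality and uniqueness at once.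
\<close>

lemma mcc_eqI:
  assumes "\<beta> \<in> convex hull \<Phi>" "\<And>a. a \<in> \<Phi> \<Longrightarrow> inner \<beta> a \<ge> inner \<beta> \<beta>"
  shows "mcc \<Phi> = \<beta>"
proof -
  have ge: "inner \<beta> w \<ge> inner \<beta> \<beta>" if "w \<in> convex hull \<Phi>" for w
  proof -
    have "convex hull \<Phi> \<subseteq> {w. inner \<beta> w \<ge> inner \<beta> \<beta>}"
      using assms(2) by (intro hull_minimal) (auto simp: convex_halfspace_ge)
    then show ?thesis
      using that by blast
  qed
  have dist: "(norm (w - \<beta>))\<^sup>2 \<le> (norm w)\<^sup>2 - (norm \<beta>)\<^sup>2" if "w \<in> convex hull \<Phi>" for w
    using ge [OF that] by (simp add: power2_norm_eq_inner inner_diff_left inner_diff_right inner_commute)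
  show ?thesis
    unfolding mcc_def
  proof (rule the_equality)
    have "norm \<beta> \<le> norm w" if "w \<in> convex hull \<Phi>" for w
    proof (rule power2_le_imp_le)
      show "(norm \<beta>)\<^sup>2 \<le> (norm w)\<^sup>2"
        using dist [OF that] zero_le_power2 [of "norm (w - \<beta>)"] by linarith
    qed simp
    then show "\<beta> \<in> convex hull \<Phi> \<and> (\<forall>w\<in>convex hull \<Phi>. norm \<beta> \<le> norm w)"
      using assms(1) by blast
    fix v
    assume v: "v \<in> convex hull \<Phi> \<and> (\<forall>w\<in>convex hull \<Phi>. norm v \<le> norm w)"
    then have "(norm v)\<^sup>2 \<le> (norm \<beta>)\<^sup>2"
      using assms(1) by (intro power_mono) auto
    then have "(norm (v - \<beta>))\<^sup>2 \<le> 0"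
      using dist [OF conjunct1 [OF v]] by linarith
    then show "v = \<beta>"
      by simp
  qed
qed

lemma mcc_pair_eqI:
  assumes "0 \<le> s" "s \<le> 1" "\<beta> = (1 - s) *\<^sub>R a + s *\<^sub>R b"
    and "inner \<beta> a \<ge> inner \<beta> \<beta>" "inner \<beta> b \<ge> inner \<beta> \<beta>"
  shows "mcc {a, b} = \<beta>"
proof (rule mcc_eqI)
  show "\<beta> \<in> convex hull {a, b}"
    unfolding convex_hull_2_alt using assms(1-3)
    by (auto intro!: exI [of _ s] simp: algebra_simps)
qed (use assms in auto)

text \<open>
  The shortest vector of a segment is an endpoint or the foot of the perpendicular from the origin onto the line.
\<close>

lemma mcc_pair_cases:
  obtains "mcc {a, b} = a" | "mcc {a, b} = b"
  | s where "0 < s" "s < 1" "mcc {a, b} = (1 - s) *\<^sub>R a + s *\<^sub>R b" "a \<noteq> b"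
      "inner a (mcc {a, b}) = inner (mcc {a, b}) (mcc {a, b})"
      "inner b (mcc {a, b}) = inner (mcc {a, b}) (mcc {a, b})"
proof -
  consider "inner a b \<ge> inner a a" | "inner a b \<ge> inner b b"
    | "inner a b < inner a a" "inner a b < inner b b"
    by linarith
  then show ?thesis
  proof cases
    case 1
    then have "mcc {a, b} = a"
      by (intro mcc_pair_eqI [of 0]) auto
    then show ?thesis
      using that by blast
  next
    case 2
    then have "mcc {a, b} = b"
      by (intro mcc_pair_eqI [of 1]) (auto simp: inner_commute)
    then show ?thesis
      using that by blast
  next
    case 3
    \<comment> \<open>D is the squared distance of a and b, and s is the parameter of the foot of the perpendicular.\<close>
    define D where "D = (inner a a - inner a b) + (inner b b - inner a b)"
    define s where "s = (inner a a - inner a b) / D"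
    define \<beta> where "\<beta> = (1 - s) *\<^sub>R a + s *\<^sub>R b"
    have D: "D > 0"
      using 3 by (simp add: D_def)
    have s: "0 < s" "s < 1"
      using 3 D by (simp_all add: s_def D_def)
    have "inner \<beta> a - inner \<beta> b = (inner a a - inner a b) - s * D"
      by (simp add: \<beta>_def D_def inner_add_left inner_commute algebra_simps)
    then have ab: "inner \<beta> a = inner \<beta> b"
      using D by (simp add: s_def)
    have "inner \<beta> \<beta> = (1 - s) * inner \<beta> a + s * inner \<beta> b"
      by (subst (2) \<beta>_def) (simp add: inner_add_right)
    then have \<beta>: "inner \<beta> a = inner \<beta> \<beta>" "inner \<beta> b = inner \<beta> \<beta>"
      by (simp_all add: ab algebra_simps)
    then have "mcc {a, b} = \<beta>"
      using s by (intro mcc_pair_eqI [of s]) (auto simp: \<beta>_def)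
    moreover have "a \<noteq> b"
      using 3 by auto
    ultimately show ?thesis
      using that(3) [of s] s \<beta> by (simp add: inner_commute flip: \<beta>_def)
  qed
qed

section \<open>Realising pairs of weights\<close>

lemma crit_set_weight:
  assumes "deg e = d"
  shows "crit_set d (weight e) \<noteq> {}"
  unfolding crit_set_nonempty_iff_coeff3
proof (rule bexI [of _ "monom3 e"])
  have supp: "{f. coeff3 (monom3 e) f \<noteq> 0} = {e}"
    by (auto simp: coeff3_monom3)
  have ne: "monom3 e \<noteq> 0"
    using supp by auto
  show "monom3 e \<in> forms d - {0}"
    using assms ne by (auto simp: forms_iff_coeff3 coeff3_monom3)
  have "mass (monom3 e) e = 1"
    using sum_mass [OF ne] by (simp add: supp)
  then have "(\<Sum>f | coeff3 (monom3 e) f \<noteq> 0. mass (monom3 e) f *\<^sub>R weight f) = weight e"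
    by (simp add: supp)
  moreover have "inner (pd k (monom3 e)) (pd l (monom3 e)) = 0" if "k \<noteq> l" for k l
  proof (rule inner_pd_eq_0 [OF _ that])
    fix f g
    assume "coeff3 (monom3 e) f \<noteq> 0" "coeff3 (monom3 e) g \<noteq> 0"
    then have "f = e" "g = e"
      using supp by blast+
    then show "weight g - weight f \<notin> roots"
      by (simp add: zero_notin_roots)
  qed
  ultimately show "(\<forall>f. coeff3 (monom3 e) f \<noteq> 0 \<longrightarrow> inner (weight f) (weight e) = inner (weight e) (weight e)) \<and>
      (\<Sum>f | coeff3 (monom3 e) f \<noteq> 0. mass (monom3 e) f *\<^sub>R weight f) = weight e \<and>
      (\<forall>k l. k \<noteq> l \<longrightarrow> inner (pd k (monom3 e)) (pd l (monom3 e)) = 0)"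
    by (auto simp: coeff3_monom3)
qed

lemma roots_uminus: "- x \<in> roots \<longleftrightarrow> x \<in> roots"
proof -
  have "- y \<in> roots" if y: "y \<in> roots" for y
  proof -
    obtain i j :: 3 where "i \<noteq> j" "y = axis i 1 - axis j 1"
      using y by (auto simp: roots_def)
    then have "j \<noteq> i" "- y = axis j 1 - axis i 1"
      by simp_all
    then show ?thesis
      unfolding roots_def by blast
  qed
  from this [of x] this [of "- x"] show ?thesis
    by auto
qed

lemma crit_set_pair:
  assumes e: "deg e = d" and f: "deg f = d" and "e \<noteq> f"
    and roots: "weight f - weight e \<notin> roots"
    and s: "0 < s" "s < 1" and \<beta>: "\<beta> = (1 - s) *\<^sub>R weight e + s *\<^sub>R weight f"
    "inner (weight e) \<beta> = inner \<beta> \<beta>" "inner (weight f) \<beta> = inner \<beta> \<beta>"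
  shows "crit_set d \<beta> \<noteq> {}"
proof -
  \<comment> \<open>The coefficients give q unit norm and the two monomials the masses 1 - s and s.\<close>
  define q where "q = sqrt ((1 - s) / fact_exp e) *\<^sub>R monom3 e + sqrt (s / fact_exp f) *\<^sub>R monom3 f"
  have pos: "0 < fact_exp e" "0 < fact_exp f"
    by (rule fact_exp_pos)+
  have ce: "coeff3 q e = sqrt ((1 - s) / fact_exp e)" and cf: "coeff3 q f = sqrt (s / fact_exp f)"
    and c0: "g \<noteq> e \<Longrightarrow> g \<noteq> f \<Longrightarrow> coeff3 q g = 0" for g
    using \<open>e \<noteq> f\<close> by (simp_all add: q_def coeff3_monom3)
  have supp: "{g. coeff3 q g \<noteq> 0} = {e, f}"
    using c0 s pos by (auto simp: ce cf)
  then have q0: "q \<noteq> 0"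
    by force
  have "(norm q)\<^sup>2 = 1"
    using s pos \<open>e \<noteq> f\<close> by (simp add: norm_squared_eq supp ce cf)
  then have mass: "mass q e = 1 - s" "mass q f = s"
    using s pos by (simp_all add: mass_def ce cf)
  have in_supp: "g = e \<or> g = f" if "coeff3 q g \<noteq> 0" for g
    using supp that by blast
  have "q \<in> forms d"
    using in_supp e f by (auto simp: forms_iff_coeff3)
  moreover have "(\<Sum>g | coeff3 q g \<noteq> 0. mass q g *\<^sub>R weight g) = \<beta>"
    using \<open>e \<noteq> f\<close> by (simp add: supp mass \<beta>)
  moreover have "weight e - weight f \<notin> roots"
    using roots roots_uminus [of "weight f - weight e"] by simp
  then have "weight h - weight g \<notin> roots" if "coeff3 q g \<noteq> 0" "coeff3 q h \<noteq> 0" for g h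
    using in_supp [OF that(1)] in_supp [OF that(2)] roots by (auto simp: zero_notin_roots)
  then have "inner (pd k q) (pd l q) = 0" if "k \<noteq> l" for k l
    using that by (rule inner_pd_eq_0)
  ultimately show ?thesis
    unfolding crit_set_nonempty_iff_coeff3 using q0 in_supp \<beta>(2,3)
    by (intro bexI [of _ q]) auto
qed

section \<open>Critical values are realised by pairs\<close>

text \<open>
  The central point \<open>-(d/3)(1,1,1)\<close> is orthogonal to the plane of the weights, hence it is the shortest vector of
  any segment of weights containing it. With \<open>k = d div 3\<close>, such a segment joins \<open>-(k, k, d - 2k)\<close> to
  \<open>-(k + 1, k + 1, d - 2k - 2)\<close>, and the last coordinate of the difference is too large for a root. If 3 divides
  \<open>d\<close>, the central point is itself a weight; otherwise \<open>d \<ge> 2\<close> is exactly what makes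
  \<open>d - 2k - 2\<close> nonnegative.
\<close>

lemma central_value_mcc:
  fixes d :: nat
  assumes "d \<ge> 2" and \<beta>: "\<And>i. \<beta> $ i = - real d / 3"
  shows "\<exists>a b. \<beta> = mcc {a, b} \<and> a \<in> weights d \<and> b \<in> weights d \<and> b - a \<notin> roots"
proof -
  define k where "k = d div 3"
  define s where "s = real d / 3 - real k"
  have d: "real d = 3 * real k + real (d mod 3)"
    unfolding k_def by (metis of_nat_add of_nat_mult of_nat_numeral div_mult_mod_eq mult.commute)
  have \<beta>w: "inner \<beta> (weight e) = inner \<beta> \<beta>" if "deg e = d" for e
  proof -
    have "inner \<beta> v = - real d / 3 * (\<Sum>i\<in>UNIV. v $ i)" for v
      by (simp add: inner_vec_def \<beta> sum_distrib_left)
    moreover have "(\<Sum>i\<in>UNIV. \<beta> $ i) = - real d"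
      by (simp add: \<beta>)
    ultimately show ?thesis
      using that by (simp add: sum_weight)
  qed
  show ?thesis
  proof (cases "d mod 3 = 0")
    case True
    define e :: "nat^3" where "e = (\<chi> i. k)"
    have e: "deg e = d" "\<beta> = weight e"
      using True d \<beta> by (simp_all add: e_def deg_def k_def vec_eq_iff weight_nth) 
    have "mcc {weight e, weight e} = \<beta>"
      by (rule mcc_pair_eqI [of 0]) (simp_all add: e)
    moreover have "weight e - weight e \<notin> roots"
      by (simp add: zero_notin_roots)
    ultimately show ?thesis
      using e(1) by (metis (mono_tags, lifting) imageI mem_Collect_eq weights_eq)
  next
    case False
    define e :: "nat^3" where "e = (\<chi> i. if i = 3 then d - 2 * k else k)"
    define f :: "nat^3" where "f = (\<chi> i. if i = 3 then d - 2 * k - 2 else k + 1)"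
    have le: "2 * k + 2 \<le> d"
      using False \<open>d \<ge> 2\<close> unfolding k_def by presburger
    have nth: "e $ 1 = k" "e $ 2 = k" "e $ 3 = d - 2 * k" "f $ 1 = k + 1" "f $ 2 = k + 1" "f $ 3 = d - 2 * k - 2"
      by (simp_all add: e_def f_def)
    have deg: "deg e = d" "deg f = d"
      using le by (simp_all add: deg_def sum_3 nth)
    have "real (d mod 3) \<le> 3"
      by (simp add: order_less_imp_le)
    then have s: "0 \<le> s" "s \<le> 1"
      using d unfolding s_def by linarith+
    have "\<beta> = (1 - s) *\<^sub>R weight e + s *\<^sub>R weight f"
      using le by (simp add: vec3_eq_iff weight_nth nth \<beta> s_def of_nat_diff field_simps)
    from mcc_pair_eqI [OF s this] have "mcc {weight e, weight f} = \<beta>"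
      by (simp add: \<beta>w deg)
    moreover have "weight f - weight e \<notin> roots"
    proof
      assume "weight f - weight e \<in> roots"
      then obtain i j :: 3 where "weight f - weight e = axis i 1 - axis j 1"
        by (auto simp: roots_def)
      then have "(weight f - weight e) $ 3 = (axis i 1 - axis j 1 :: real^3) $ 3"
        by simp
      moreover have "(weight f - weight e) $ 3 = 2"
        using le by (simp add: weight_nth nth of_nat_diff)
      ultimately show False
        by (simp add: axis_def split: if_splits)
    qed
    ultimately show ?thesis
      using deg by (metis (mono_tags, lifting) imageI mem_Collect_eq weights_eq)
  qed
qed

text \<open>
  A linear form \<open>q = \<Sum> a\<^sub>i x\<^sub>i\<close> has \<open>\<langle>\<partial>\<^sub>1 q, \<partial>\<^sub>2 q\<rangle> = a\<^sub>1 a\<^sub>2\<close>, while the first two coordinates of the barycentre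
  are negative multiples of \<open>a\<^sub>1\<^sup>2\<close> and \<open>a\<^sub>2\<^sup>2\<close>.
\<close>

lemma linear_form_not_central:
  assumes q: "q \<in> forms 1" and bary: "(\<Sum>e | coeff3 q e \<noteq> 0. mass q e *\<^sub>R weight e) = \<beta>"
    and \<beta>: "\<beta> $ 1 \<noteq> 0" "\<beta> $ 2 \<noteq> 0"
  shows "inner (pd 1 q) (pd 2 q) \<noteq> 0"
proof -
  have deg: "deg e = 1" if "coeff3 q e \<noteq> 0" for e
    using q that by (simp add: forms_iff_coeff3)
  have "coeff3 q (0 + axis k 1) \<noteq> 0" if "\<beta> $ k \<noteq> 0" for k
  proof -
    have "\<exists>e. coeff3 q e \<noteq> 0 \<and> e $ k \<noteq> 0"
    proof (rule ccontr)
      assume "\<not> ?thesis"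
      then have "(\<Sum>e | coeff3 q e \<noteq> 0. mass q e * weight e $ k) = 0"
        by (intro sum.neutral) (auto simp: weight_nth)
      then show False
        using that by (simp flip: bary)
    qed
    then obtain e where e: "coeff3 q e \<noteq> 0" "e $ k \<noteq> 0"
      by blast
    then have ek: "(e - axis k 1) + axis k 1 = e"
      using add_axis_eq_iff [of "e - axis k 1" k e] by simp
    then have "deg (e - axis k 1) = 0"
      using deg [OF e(1)] deg_add_axis [of "e - axis k 1" k] by simp
    then have "e - axis k 1 = 0"
      by (simp add: deg_def vec_eq_iff)
    then show ?thesis
      using e ek by simp
  qed
  note this [OF \<beta>(1)] this [OF \<beta>(2)]
  moreover have "coeff3 q (f + axis 1 1) = 0" if "f \<noteq> 0" for f
  proof (rule ccontr)
    assume "coeff3 q (f + axis 1 1) \<noteq> 0"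
    then have "deg f = 0"
      using deg [of "f + axis 1 1"] by (simp add: deg_add_axis)
    then show False
      using that by (simp add: deg_def vec_eq_iff)
  qed
  ultimately show ?thesis
    by (intro inner_pd_single [of 0]) auto
qed

text \<open>
  The vector \<open>n\<close> is the cross product of \<open>\<beta>\<close> and \<open>(1,1,1)\<close>. Subtracting \<open>\<beta>\<close> from \<open>v\<close> gives a vector orthogonal to
  both factors, hence parallel to \<open>n\<close>; the equation is stated so that it also covers \<open>n = 0\<close>.
\<close>

lemma perp_line:
  fixes \<beta> v :: "real^3"
  defines "n \<equiv> vector [\<beta> $ 2 - \<beta> $ 3, \<beta> $ 3 - \<beta> $ 1, \<beta> $ 1 - \<beta> $ 2] :: real^3"
  assumes "(\<Sum>i\<in>UNIV. v $ i) = (\<Sum>i\<in>UNIV. \<beta> $ i)" "inner v \<beta> = inner \<beta> \<beta>"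
  shows "inner n n *\<^sub>R (v - \<beta>) = inner v n *\<^sub>R n"
proof -
  have n: "n $ 1 = \<beta> $ 2 - \<beta> $ 3" "n $ 2 = \<beta> $ 3 - \<beta> $ 1" "n $ 3 = \<beta> $ 1 - \<beta> $ 2"
    by (simp_all add: n_def)
  define x y z where xyz: "x = v $ 1 - \<beta> $ 1" "y = v $ 2 - \<beta> $ 2" "z = v $ 3 - \<beta> $ 3"
  have 1: "x + y + z = 0" and 2: "x * \<beta> $ 1 + y * \<beta> $ 2 + z * \<beta> $ 3 = 0"
    using assms(2,3) by (simp_all add: xyz inner_vec_def sum_3 algebra_simps)
  have z: "z = - x - y"
    using 1 by simp
  have "inner v n = x * n $ 1 + y * n $ 2 + z * n $ 3"
    by (simp add: inner_vec_def sum_3 n xyz algebra_simps)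
  moreover have "inner n n = (n $ 1)\<^sup>2 + (n $ 2)\<^sup>2 + (n $ 3)\<^sup>2"
    by (simp add: inner_vec_def sum_3 power2_eq_square)
  moreover have "((n $ 1)\<^sup>2 + (n $ 2)\<^sup>2 + (n $ 3)\<^sup>2) * x = (x * n $ 1 + y * n $ 2 + z * n $ 3) * n $ 1"
    "((n $ 1)\<^sup>2 + (n $ 2)\<^sup>2 + (n $ 3)\<^sup>2) * y = (x * n $ 1 + y * n $ 2 + z * n $ 3) * n $ 2"
    "((n $ 1)\<^sup>2 + (n $ 2)\<^sup>2 + (n $ 3)\<^sup>2) * z = (x * n $ 1 + y * n $ 2 + z * n $ 3) * n $ 3"
    using 1 2 unfolding n by algebra+
  ultimately show ?thesis
    by (simp add: vec3_eq_iff xyz)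
qed

text \<open>
  The pair consists of the extreme weights of the form on the line perpendicular to \<open>\<beta>\<close>, except when
  \<open>\<beta>\<close> is central, where the weights need not be collinear.
\<close>

lemma crit_set_imp_mcc_pair:
  assumes d: "d \<ge> 1" and crit: "crit_set d \<beta> \<noteq> {}"
  shows "\<exists>a b. \<beta> = mcc {a, b} \<and> a \<in> weights d \<and> b \<in> weights d \<and> b - a \<notin> roots"
proof -
  obtain q where q: "q \<in> forms d" "q \<noteq> 0"
    and eig: "\<And>e. coeff3 q e \<noteq> 0 \<Longrightarrow> inner (weight e) \<beta> = inner \<beta> \<beta>"
    and bary: "(\<Sum>e | coeff3 q e \<noteq> 0. mass q e *\<^sub>R weight e) = \<beta>"
    and offdiag: "\<And>k l. k \<noteq> l \<Longrightarrow> inner (pd k q) (pd l q) = 0"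
    using crit unfolding crit_set_nonempty_iff_coeff3 by blast
  define S where "S = {e. coeff3 q e \<noteq> 0}"
  have finS: "finite S" and S0: "S \<noteq> {}"
    using finite_coeff3 coeff3_ext [of q 0] q(2) by (auto simp: S_def)
  have deg: "deg e = d" if "e \<in> S" for e
    using q(1) that by (simp add: S_def forms_iff_coeff3)
  have mass1: "(\<Sum>e\<in>S. mass q e) = 1"
    using sum_mass [OF q(2)] by (simp add: S_def)
  have \<beta>_sum: "(\<Sum>i\<in>UNIV. \<beta> $ i) = - real d"
  proof -
    have "(\<Sum>i\<in>UNIV. \<beta> $ i) = (\<Sum>i\<in>UNIV. \<Sum>e\<in>S. mass q e * weight e $ i)"
      by (simp add: S_def flip: bary)
    also have "\<dots> = (\<Sum>e\<in>S. mass q e * (\<Sum>i\<in>UNIV. weight e $ i))"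
      by (subst sum.swap) (simp add: sum_distrib_left)
    also have "\<dots> = (\<Sum>e\<in>S. mass q e * (- real d))"
      by (intro sum.cong) (simp_all add: sum_weight deg)
    also have "\<dots> = - real d"
      unfolding sum_distrib_right [symmetric] mass1 by simp
    finally show ?thesis .
  qed
  define n :: "real^3" where "n = vector [\<beta> $ 2 - \<beta> $ 3, \<beta> $ 3 - \<beta> $ 1, \<beta> $ 1 - \<beta> $ 2]"
  have n_nth: "n $ 1 = \<beta> $ 2 - \<beta> $ 3" "n $ 2 = \<beta> $ 3 - \<beta> $ 1" "n $ 3 = \<beta> $ 1 - \<beta> $ 2"
    by (simp_all add: n_def)
  show ?thesis
  proof (cases "n = 0")
    case True
    then have "\<beta> $ 1 = \<beta> $ 2" "\<beta> $ 2 = \<beta> $ 3"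
      using n_nth(1,3) by simp_all
    then have central: "\<beta> $ i = - real d / 3" for i
      using \<beta>_sum exhaust_3 [of i] by (auto simp: sum_3)
    have "d \<noteq> 1"
    proof
      assume "d = 1"
      then have "inner (pd 1 q) (pd 2 q) \<noteq> 0"
        using q(1) central by (intro linear_form_not_central [OF _ bary]) auto
      then show False
        using offdiag [of 1 2] by simp
    qed
    then show ?thesis
      using d central by (intro central_value_mcc) auto
  next
    case False
    \<comment> \<open>t is the coordinate of a weight on the line, with origin at \<open>\<beta>\<close>.\<close>
    define t where "t e = inner (weight e) n / inner n n" for e
    have line: "weight e = \<beta> + t e *\<^sub>R n" if "e \<in> S" for e
    proof -
      have "inner n n *\<^sub>R (weight e - \<beta>) = inner (weight e) n *\<^sub>R n"
        unfolding n_def using that by (intro perp_line) (simp_all add: sum_weight deg \<beta>_sum eig S_def)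
      then have "inverse (inner n n) *\<^sub>R (inner n n *\<^sub>R (weight e - \<beta>)) = t e *\<^sub>R n"
        by (simp add: t_def divide_inverse mult.commute)
      then show ?thesis
        using False by (simp add: algebra_simps)
    qed
    have "inner \<beta> n = 0"
      by (simp add: inner_vec_def sum_3 n_nth algebra_simps)
    then have t0: "(\<Sum>e\<in>S. mass q e * t e) = 0"
      using arg_cong [OF bary, of "\<lambda>v. inner v n / inner n n"]
      by (simp add: S_def t_def inner_sum_left sum_divide_distrib)
    obtain e where e: "e \<in> S" "\<And>g. g \<in> S \<Longrightarrow> t e \<le> t g"
      using ex_min_if_finite [of "t ` S"] finS S0 by (auto simp: not_less)
    obtain f where f: "f \<in> S" "\<And>g. g \<in> S \<Longrightarrow> t g \<le> t f"
      using ex_min_if_finite [of "(\<lambda>g. - t g) ` S"] finS S0 by (auto simp: not_less)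
    have "t e = (\<Sum>g\<in>S. mass q g * t e)" "t f = (\<Sum>g\<in>S. mass q g * t f)"
      using mass1 by (simp_all flip: sum_distrib_right)
    moreover have "(\<Sum>g\<in>S. mass q g * t e) \<le> (\<Sum>g\<in>S. mass q g * t g)"
      "(\<Sum>g\<in>S. mass q g * t g) \<le> (\<Sum>g\<in>S. mass q g * t f)"
      using e f by (auto intro!: sum_mono mult_left_mono mass_nonneg)
    ultimately have te: "t e \<le> 0" and tf: "0 \<le> t f"
      using t0 by simp_all
    show ?thesis
    proof (cases "t e = t f")
      case True
      then have "weight e = \<beta>"
        using te tf line [OF e(1)] by simp
      moreover have "mcc {\<beta>, \<beta>} = \<beta>"
        by (rule mcc_pair_eqI [of 0]) simp_all
      ultimately show ?thesis
        using deg [OF e(1)] zero_notin_roots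
        by (intro exI [of _ \<beta>]) (auto simp: weights_eq)
    next
      case False
      then have lt: "t e < t f"
        using te tf by simp
      \<comment> \<open>The parameter at which the segment from e to f passes through the origin of the coordinate t.\<close>
      define s where "s = - t e / (t f - t e)"
      have s: "0 \<le> s" "s \<le> 1"
        using lt te tf by (simp_all add: s_def field_simps)
      have "(1 - s) * t e + s * t f = t e + s * (t f - t e)"
        by (simp add: algebra_simps)
      also have "\<dots> = 0"
        using lt by (simp add: s_def)
      finally have "\<beta> + ((1 - s) * t e + s * t f) *\<^sub>R n = \<beta>"
        by simp
      then have "\<beta> = (1 - s) *\<^sub>R weight e + s *\<^sub>R weight f"
        unfolding line [OF e(1)] line [OF f(1)] by (simp add: algebra_simps)
      from mcc_pair_eqI [OF s this] have mcc: "mcc {weight e, weight f} = \<beta>"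
        using eig e(1) f(1) by (simp add: S_def inner_commute)
      have "weight f - weight e \<notin> roots"
      proof
        assume "weight f - weight e \<in> roots"
        then obtain k l where kl: "k \<noteq> l" "weight f - weight e = axis k 1 - axis l 1"
          by (auto simp: roots_def)
        define g where "g = e - axis k 1"
        have ef: "real (e $ i) - real (f $ i) = axis k 1 $ i - axis l 1 $ i" for i
          using arg_cong [OF kl(2), of "\<lambda>v. v $ i"] by (simp add: weight_nth)
        have "e $ k > 0"
          using ef [of k] kl(1) by (simp add: axis_def)
        then have ge: "g + axis k 1 = e"
          using add_axis_eq_iff [of g k e] by (simp add: g_def)
        have "weight (g + axis l 1) = weight f"
          using kl(2) by (simp add: weight_add_axis algebra_simps flip: ge)
        then have gf: "g + axis l 1 = f"
          by (simp add: weight_inject)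
        \<comment> \<open>A root has coordinates 0, 1 and -1, so the position u of a lattice point between e and f is an integer.\<close>
        have ends: "h = e \<or> h = f" if h: "h \<in> S" for h
        proof -
          define u where "u = (t h - t e) / (t f - t e)"
          have u: "0 \<le> u" "u \<le> 1"
            using e(2) [OF h] f(2) [OF h] lt by (simp_all add: u_def)
          have "weight h - weight e = (t h - t e) *\<^sub>R n"
            by (simp add: line h e(1) algebra_simps)
          also have "\<dots> = u *\<^sub>R ((t f - t e) *\<^sub>R n)"
            using lt by (simp add: u_def)
          also have "(t f - t e) *\<^sub>R n = weight f - weight e"
            by (simp add: line f(1) e(1) algebra_simps)
          finally have hu: "weight h - weight e = u *\<^sub>R (weight f - weight e)" .
          have "real (e $ k) - real (h $ k) = u"
            using arg_cong [OF hu, of "\<lambda>v. v $ k"] kl by (simp add: weight_nth axis_def)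
          then have u_int: "u = of_int (int (e $ k) - int (h $ k))"
            by simp
          with u have "int (e $ k) - int (h $ k) = 0 \<or> int (e $ k) - int (h $ k) = 1"
            by linarith
          then have "u = 0 \<or> u = 1"
            using u_int by auto
          then show ?thesis
            using hu by (auto simp: weight_inject)
        qed
        have "inner (pd k q) (pd l q) \<noteq> 0"
        proof (rule inner_pd_single)
          show "coeff3 q (g + axis k 1) \<noteq> 0" "coeff3 q (g + axis l 1) \<noteq> 0"
            using e(1) f(1) by (simp_all add: ge gf S_def)
          fix h assume "h \<noteq> g"
          show "coeff3 q (h + axis k 1) = 0 \<or> coeff3 q (h + axis l 1) = 0"
          proof (rule ccontr)
            assume "\<not> ?thesis"
            then have "h + axis k 1 = g + axis k 1 \<or> h + axis k 1 = g + axis l 1"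
              "h + axis l 1 = g + axis k 1 \<or> h + axis l 1 = g + axis l 1"
              using ends by (auto simp: S_def ge gf)
            then have "h + axis k 1 = g + axis l 1" "h + axis l 1 = g + axis k 1"
              using \<open>h \<noteq> g\<close> by auto
            then have "(h + axis k 1) $ k = (g + axis l 1) $ k" "(h + axis l 1) $ k = (g + axis k 1) $ k"
              by simp_all
            then show False
              using kl(1) by (simp add: axis_def)
          qed
        qed
        then show False
          using offdiag kl(1) by blast
      qed
      then show ?thesis
        using mcc deg e(1) f(1) by (intro exI [of _ "weight e"] exI [of _ "weight f"]) (auto simp: weights_eq)
    qed
  qed
qed

theorem theorem5p5:
  fixes d :: nat
  assumes "d \<ge> 1"
  shows "stratifying_set d =
    {mcc {\<alpha>\<^sub>i, \<alpha>\<^sub>j} | \<alpha>\<^sub>i \<alpha>\<^sub>j.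
      \<alpha>\<^sub>i \<in> weights d \<and> \<alpha>\<^sub>j \<in> weights d \<and> \<alpha>\<^sub>j - \<alpha>\<^sub>i \<notin> roots} \<inter> closure a_plus"
proof -
  have "crit_set d (mcc {a, b}) \<noteq> {}" if ab: "a \<in> weights d" "b \<in> weights d" "b - a \<notin> roots" for a b
  proof -
    obtain e f where e: "deg e = d" "a = weight e" and f: "deg f = d" "b = weight f"
      using ab by (auto simp: weights_eq)
    show ?thesis
    proof (cases rule: mcc_pair_cases [of a b])
      case 1
      then show ?thesis
        using crit_set_weight [OF e(1)] e(2) by simp
    next
      case 2
      then show ?thesis
        using crit_set_weight [OF f(1)] f(2) by simp
    next
      case (3 s)
      then have "e \<noteq> f"
        using e f by blast
      then show ?thesis
        using 3 ab e f by (intro crit_set_pair [of e d f s]) auto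
    qed
  qed
  then show ?thesis
    using crit_set_imp_mcc_pair [OF assms] unfolding stratifying_set_def by auto
qed

end
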